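(* Let $H^2=\{(x,y)\in\mathbb{R}^2: y>0\}$ and $\overline{H}{}^2=\{y\ge 0\}$. Assume $\varphi\in C^0(\overline{H}{}^2)\cap C^2(H^2)$ satisfies $$y(\varphi_{xx}+\varphi_{yy})-\varphi_y=0\quad\text{in }H^2,$$ with the boundary condition $\varphi(x,0)=0$ for all $x\in\mathbb{R}$. Assume there are constants $A,B,C\ge 0$ and $\delta\in[0,2)$ with $$\varphi(x,y)>-A-B|x|-Cy^{\delta}\quad\text{on }H^2.$$ Then $\varphi\ge 0$, and $\varphi=C_1y^2$ for some constant $C_1\ge 0$.
   Context: Subscripts $x,y$ denote partial derivatives. *)

theory Defs
  imports "HOL-Analysis.Analysis"
begin

definition upper_half_plane :: "(real \<times> real) set" where
  "upper_half_plane = {(x, y). y > 0}"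

definition closed_upper_half_plane :: "(real \<times> real) set" where
  "closed_upper_half_plane = {(x, y). y \<ge> 0}"

definition pderiv_x :: "(real \<times> real \<Rightarrow> real) \<Rightarrow> real \<times> real \<Rightarrow> real" where
  "pderiv_x f = (\<lambda>(x, y). deriv (\<lambda>s. f (s, y)) x)"

definition pderiv_y :: "(real \<times> real \<Rightarrow> real) \<Rightarrow> real \<times> real \<Rightarrow> real" where
  "pderiv_y f = (\<lambda>(x, y). deriv (\<lambda>t. f (x, t)) y)"

(* The existence of the partial derivatives has to be required explicitly, because "deriv" is
   total. The notions below are meant for open sets U. *)

definition C1_on :: "(real \<times> real) set \<Rightarrow> (real \<times> real \<Rightarrow> real) \<Rightarrow> bool" where
  "C1_on U f \<longleftrightarrow>
     (\<forall>(x, y)\<in>U. (\<lambda>s. f (s, y)) differentiable (at x) \<and> (\<lambda>t. f (x, t)) differentiable (at y)) \<and>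
     continuous_on U f \<and> continuous_on U (pderiv_x f) \<and> continuous_on U (pderiv_y f)"

definition C2_on :: "(real \<times> real) set \<Rightarrow> (real \<times> real \<Rightarrow> real) \<Rightarrow> bool" where
  "C2_on U f \<longleftrightarrow> C1_on U f \<and> C1_on U (pderiv_x f) \<and> C1_on U (pderiv_y f)"

end

(* In the coordinates x = r t, y = r sqrt (1 - t^2) the equation reads
   r^2 phi_rr + (1 - t^2) phi_tt = 0. Hence the moments m_n (r), the integrals of phi t^n over
   -1 <= t <= 1, satisfy r^2 m_n'' = (n + 1) (n + 2) m_n - n (n - 1) m_(n-2).
   For n = 0 boundedness at 0 leaves only m_0 (r) = c r^2. Together with the lower bound this
   controls the integral of |phi| over a half circle, and so every m_n, by a constant times
   1 + r^2. For n >= 1 the homogeneous solutions r^(n+2) and r^(-n-1) are then excluded, so that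
   all the moments are those of (3/4) c y^2, and the Weierstrass approximation theorem identifies
   phi with this function. Its coefficient is nonnegative because delta < 2.

   No control of the derivatives of phi at the boundary is available, so the equation for m_n is
   obtained only in a weak sense, from test functions cut off near t = -1 and t = 1. *)
theory Submission
  imports Defs
begin

section \<open>Barriers for the Euler equation\<close>

text \<open>The moment recursion is a double integration by parts in t: (1 - t^2) t^n vanishes at t
  = -1 and t = 1, and its second derivative is n (n - 1) t^(n-2) - (n + 1) (n + 2) t^n. As the
  t-derivative of \<phi> may blow up at the ends, this test function is multiplied by (1 - h / (1 -
  t^2))^2, which has a double zero where 1 - t^2 = h. The price is an error of size h + h^2 / (1 -
  t^2)^3, whose integral over 1 - t^2 >= h stays bounded but does not tend to 0 with h. It becomes
  small only through the boundary condition: for bounded r and any \<epsilon> > 0 there is D with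
  |\<phi>| <= \<epsilon> + D (1 - t^2)^3, the cubic weight cancels the singularity, and what remains
  is O(\<epsilon> + D h), uniformly in r. So \<epsilon> is fixed first, then D, then h. The
  resulting equation is used only for comparison with explicit solutions on [a, b]. The maximum
  principle is applied to the twice differentiable approximants, and its conclusion survives the
  uniform limit.\<close>

lemma second_derivative_nonpos_at_max:
  fixes f :: "real \<Rightarrow> real"
  assumes "a < x" "x < b"
    and f': "\<And>y. y \<in> {a<..<b} \<Longrightarrow> (f has_real_derivative f' y) (at y)"
    and f'': "(f' has_real_derivative D) (at x)"
    and max: "\<And>y. y \<in> {a<..<b} \<Longrightarrow> f y \<le> f x"
  shows "D \<le> 0"
proof (rule ccontr)
  assume "\<not> D \<le> 0"
  then have "D > 0" by simp
  have f'0: "f' x = 0"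
  proof (rule DERIV_local_max[OF f'])
    show "x \<in> {a<..<b}" using assms by simp
    show "0 < min (x - a) (b - x)" using assms by simp
    show "\<forall>y. \<bar>x - y\<bar> < min (x - a) (b - x) \<longrightarrow> f y \<le> f x"
      using max by (auto simp: abs_less_iff)
  qed
  obtain d where d: "d > 0" "\<And>h. 0 < h \<Longrightarrow> h < d \<Longrightarrow> f' x < f' (x + h)"
    using DERIV_pos_inc_right[OF f'' \<open>D > 0\<close>] by blast
  define c where "c = min d (b - x)"
  have c: "0 < c" "c \<le> d" "c \<le> b - x" using d(1) assms(2) by (auto simp: c_def)
  define y where "y = x + c / 2"
  have y: "x < y" "y < x + d" "y < b" using c by (auto simp: y_def)
  obtain z where z: "x < z" "z < y" "f y - f x = (y - x) * f' z"
    using MVT2[of x y f f'] y f' assms by auto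
  have "f' z > 0" using d(2)[of "z - x"] z y f'0 by auto
  then have "f y > f x" using z y by (smt (verit) mult_pos_pos)
  moreover have "f y \<le> f x" using max y assms(1) by simp
  ultimately show False by simp
qed

text \<open>The function \<open>d\<close> solves \<open>r\<^sup>2 d'' = F\<close> on the positive half line as a limit of
  twice differentiable functions. Neither derivative of \<open>d\<close> is asserted to exist.\<close>
definition weak_ode :: "(real \<Rightarrow> real) \<Rightarrow> (real \<Rightarrow> real) \<Rightarrow> bool" where
  "weak_ode F d \<longleftrightarrow> (\<forall>a b e. 0 < a \<longrightarrow> a < b \<longrightarrow> 0 < e \<longrightarrow>
     (\<exists>g g' g''. \<forall>r\<in>{a..b}.
        (g has_real_derivative g' r) (at r) \<and> (g' has_real_derivative g'' r) (at r) \<and>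
        \<bar>g r - d r\<bar> \<le> e \<and> \<bar>r\<^sup>2 * g'' r - F r\<bar> \<le> e))"

lemma weak_odeE:
  assumes "weak_ode F d" "0 < a" "a < b" "0 < e"
  obtains g g' g'' where
    "\<And>r. r \<in> {a..b} \<Longrightarrow> (g has_real_derivative g' r) (at r)"
    "\<And>r. r \<in> {a..b} \<Longrightarrow> (g' has_real_derivative g'' r) (at r)"
    "\<And>r. r \<in> {a..b} \<Longrightarrow> \<bar>g r - d r\<bar> \<le> e"
    "\<And>r. r \<in> {a..b} \<Longrightarrow> \<bar>r\<^sup>2 * g'' r - F r\<bar> \<le> e"
proof -
  have "\<exists>g g' g''. \<forall>r\<in>{a..b}.
        (g has_real_derivative g' r) (at r) \<and> (g' has_real_derivative g'' r) (at r) \<and>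
        \<bar>g r - d r\<bar> \<le> e \<and> \<bar>r\<^sup>2 * g'' r - F r\<bar> \<le> e"
    using assms unfolding weak_ode_def by blast
  then show ?thesis using that by blast
qed

lemma weak_ode_uminus:
  assumes "weak_ode F d"
  shows "weak_ode (\<lambda>r. - F r) (\<lambda>r. - d r)"
  unfolding weak_ode_def
proof (intro allI impI)
  fix a b e :: real assume "0 < a" "a < b" "0 < e"
  then obtain g g' g'' where g:
    "\<And>r. r \<in> {a..b} \<Longrightarrow> (g has_real_derivative g' r) (at r)"
    "\<And>r. r \<in> {a..b} \<Longrightarrow> (g' has_real_derivative g'' r) (at r)"
    "\<And>r. r \<in> {a..b} \<Longrightarrow> \<bar>g r - d r\<bar> \<le> e"
    "\<And>r. r \<in> {a..b} \<Longrightarrow> \<bar>r\<^sup>2 * g'' r - F r\<bar> \<le> e"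
    using weak_odeE[OF assms] by metis
  show "\<exists>g g' g''. \<forall>r\<in>{a..b}.
        (g has_real_derivative g' r) (at r) \<and> (g' has_real_derivative g'' r) (at r) \<and>
        \<bar>g r - - d r\<bar> \<le> e \<and> \<bar>r\<^sup>2 * g'' r - - F r\<bar> \<le> e"
    by (rule exI[of _ "\<lambda>r. - g r"], rule exI[of _ "\<lambda>r. - g' r"], rule exI[of _ "\<lambda>r. - g'' r"])
      (use g in \<open>force intro!: DERIV_minus simp: abs_le_iff\<close>)
qed

text \<open>For subtracting a particular solution of the moment equation, as r^2 (c r^2)'' = 2 c
  r^2.\<close>

lemma weak_ode_add_square:
  assumes "weak_ode F d"
  shows "weak_ode (\<lambda>r. F r + 2 * c * r\<^sup>2) (\<lambda>r. d r + c * r\<^sup>2)"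
  unfolding weak_ode_def
proof (intro allI impI)
  fix a b e :: real assume "0 < a" "a < b" "0 < e"
  then obtain g g' g'' where g:
    "\<And>r. r \<in> {a..b} \<Longrightarrow> (g has_real_derivative g' r) (at r)"
    "\<And>r. r \<in> {a..b} \<Longrightarrow> (g' has_real_derivative g'' r) (at r)"
    "\<And>r. r \<in> {a..b} \<Longrightarrow> \<bar>g r - d r\<bar> \<le> e"
    "\<And>r. r \<in> {a..b} \<Longrightarrow> \<bar>r\<^sup>2 * g'' r - F r\<bar> \<le> e"
    using weak_odeE[OF assms] by metis
  have "(\<lambda>r. g r + c * r\<^sup>2, r) = (\<lambda>r. g r + c * r\<^sup>2, r)" for r :: real ..
  show "\<exists>g g' g''. \<forall>r\<in>{a..b}.
        (g has_real_derivative g' r) (at r) \<and> (g' has_real_derivative g'' r) (at r) \<and>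
        \<bar>g r - (d r + c * r\<^sup>2)\<bar> \<le> e \<and> \<bar>r\<^sup>2 * g'' r - (F r + 2 * c * r\<^sup>2)\<bar> \<le> e"
  proof (rule exI[of _ "\<lambda>r. g r + c * r\<^sup>2"], rule exI[of _ "\<lambda>r. g' r + 2 * c * r"],
      rule exI[of _ "\<lambda>r. g'' r + 2 * c"], intro ballI conjI)
    fix r assume r: "r \<in> {a..b}"
    show "((\<lambda>r. g r + c * r\<^sup>2) has_real_derivative g' r + 2 * c * r) (at r)"
      by (auto intro!: derivative_eq_intros g(1)[OF r])
    show "((\<lambda>r. g' r + 2 * c * r) has_real_derivative g'' r + 2 * c) (at r)"
      by (auto intro!: derivative_eq_intros g(2)[OF r])
    show "\<bar>g r + c * r\<^sup>2 - (d r + c * r\<^sup>2)\<bar> \<le> e" using g(3)[OF r] by simp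
    show "\<bar>r\<^sup>2 * (g'' r + 2 * c) - (F r + 2 * c * r\<^sup>2)\<bar> \<le> e"
      using g(4)[OF r] by (simp add: algebra_simps)
  qed
qed

text \<open>The barrier is the solution of the Euler equation \<open>r\<^sup>2 B'' = (n + 1) (n + 2) B\<close>, whose
  fundamental solutions are \<open>r\<close> to the powers \<open>n + 2\<close> and \<open>- (n + 1)\<close>.\<close>
lemma weak_ode_le_barrier:
  fixes d :: "real \<Rightarrow> real" and n :: nat
  assumes d: "weak_ode (\<lambda>r. real ((n + 1) * (n + 2)) * d r) d"
    and ab: "0 < a" "a \<le> r" "r \<le> b" "a < b"
    and da: "d a \<le> \<alpha>" "0 \<le> \<alpha>" and db: "d b \<le> \<beta>" "0 \<le> \<beta>"
  shows "d r \<le> \<alpha> * (a / r) ^ (n + 1) + \<beta> * (r / b) ^ (n + 2)"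
proof (rule field_le_epsilon)
  fix e :: real assume "e > 0"
  define L where "L = real ((n + 1) * (n + 2))"
  have L: "L > 1" unfolding L_def by (simp add: algebra_simps add_pos_nonneg)
  \<comment> \<open>Two thirds of \<open>e\<close> go into the maximum of \<open>g - B\<close>, one
    third into the passage from \<open>g\<close> to \<open>d\<close>.\<close>
  define \<epsilon> where "\<epsilon> = e / 3"
  have \<epsilon>: "\<epsilon> > 0" using \<open>e > 0\<close> by (simp add: \<epsilon>_def)
  obtain g g' g'' where g:
    "\<And>r. r \<in> {a..b} \<Longrightarrow> (g has_real_derivative g' r) (at r)"
    "\<And>r. r \<in> {a..b} \<Longrightarrow> (g' has_real_derivative g'' r) (at r)"
    "\<And>r. r \<in> {a..b} \<Longrightarrow> \<bar>g r - d r\<bar> \<le> \<epsilon>"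
    "\<And>r. r \<in> {a..b} \<Longrightarrow> \<bar>r\<^sup>2 * g'' r - L * d r\<bar> \<le> \<epsilon>"
    using weak_odeE[OF d, of a b \<epsilon>] ab \<epsilon> unfolding L_def by metis
  define B where "B r = \<alpha> * (a / r) ^ (n + 1) + \<beta> * (r / b) ^ (n + 2)" for r
  define B' where "B' r = - real (n + 1) * \<alpha> * a ^ (n + 1) / r ^ (n + 2)
    + real (n + 2) * \<beta> * r ^ (n + 1) / b ^ (n + 2)" for r
  define B'' where "B'' r = L * B r / r\<^sup>2" for r
  have B': "(B has_real_derivative B' r) (at r)" if "r > 0" for r
    unfolding B_def B'_def power_divide
    by (rule derivative_eq_intros refl | use that ab in \<open>simp add: divide_simps; fail\<close>)+
      (use that ab in \<open>simp add: divide_simps; simp add: algebra_simps power2_eq_square\<close>)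
  have B'': "(B' has_real_derivative B'' r) (at r)" if "r > 0" for r
    unfolding B_def B'_def B''_def power_divide L_def
    by (rule derivative_eq_intros refl | use that ab in \<open>simp add: divide_simps; fail\<close>)+
      (use that ab in \<open>simp add: divide_simps; simp add: algebra_simps power2_eq_square\<close>)
  define f where "f r = g r - B r" for r
  have f': "(f has_real_derivative g' r - B' r) (at r)" if "r \<in> {a..b}" for r
    unfolding f_def using that ab by (auto intro!: derivative_eq_intros g B')
  have f'': "((\<lambda>r. g' r - B' r) has_real_derivative g'' r - B'' r) (at r)" if "r \<in> {a..b}" for r
    using that ab by (auto intro!: derivative_eq_intros g B'')
  have "continuous_on {a..b} f"
    by (rule DERIV_continuous_on[where D = "\<lambda>r. g' r - B' r"])
      (rule has_field_derivative_at_within[OF f'])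
  then obtain s where s: "s \<in> {a..b}" "\<And>y. y \<in> {a..b} \<Longrightarrow> f y \<le> f s"
    using continuous_attains_sup[of "{a..b}" f] ab by auto
  \<comment> \<open>At each end one term of \<open>B\<close> equals the boundary datum and the other
    is nonnegative.\<close>
  have Ba: "\<alpha> \<le> B a" and Bb: "\<beta> \<le> B b" unfolding B_def using ab da db by auto
  have "f s \<le> 2 * \<epsilon>"
  proof -
    consider "s = a" | "s = b" | "a < s" "s < b" using s(1) by fastforce
    then show ?thesis
    proof cases
      case 1 then show ?thesis using g(3)[of a] ab da Ba \<epsilon> by (simp add: f_def)
    next
      case 2 then show ?thesis using g(3)[of b] ab db Bb \<epsilon> by (simp add: f_def)
    next
      case 3
      \<comment> \<open>At an interior maximum, s^2 g'' is within \<epsilon> of L d and s^2 B''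
        equals L B, so the sign of L bounds \<open>g - B\<close>; \<open>L > 1\<close> absorbs the
        additional \<epsilon>.\<close>
      have "g'' s - B'' s \<le> 0"
        by (rule second_derivative_nonpos_at_max[OF 3, of f "\<lambda>r. g' r - B' r"])
          (use f' f'' s in auto)
      then have "s\<^sup>2 * g'' s \<le> s\<^sup>2 * B'' s" by (simp add: mult_left_mono)
      also have "\<dots> = L * B s" using 3 ab by (simp add: B''_def)
      finally have "L * d s - \<epsilon> \<le> L * B s" using g(4)[OF s(1)] by linarith
      moreover have "L * (g s - \<epsilon>) \<le> L * d s"
        by (rule mult_left_mono) (use g(3)[OF s(1)] L in auto)
      ultimately have "L * f s \<le> L * \<epsilon> + \<epsilon>" by (simp add: f_def algebra_simps)
      also have "\<dots> \<le> L * (2 * \<epsilon>)" using L \<epsilon> by (simp add: algebra_simps)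
      finally show ?thesis using L by simp
    qed
  qed
  then have "g r \<le> B r + 2 * \<epsilon>" using s(2)[of r] ab by (fastforce simp: f_def)
  moreover have "d r \<le> g r + \<epsilon>" using g(3)[of r] ab by (simp add: abs_le_iff)
  ultimately have "d r \<le> B r + e" by (simp add: \<epsilon>_def)
  then show "d r \<le> \<alpha> * (a / r) ^ (n + 1) + \<beta> * (r / b) ^ (n + 2) + e"
    unfolding B_def .
qed

section \<open>The equation in polar coordinates\<close>

text \<open>The chain rule along curves needs the total derivative, which the joint continuity of
  \<open>pderiv_y f\<close> provides. The half plane is written as a product with a convex second
  factor, and the partial derivative as a bounded linear map, to fit
  \<open>has_derivative_partialsI\<close>.\<close>

lemma C1_on_has_derivative:
  assumes f: "C1_on upper_half_plane f" and "y > 0"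
  shows "(f has_derivative (\<lambda>(u, v). pderiv_x f (x, y) * u + pderiv_y f (x, y) * v)) (at (x, y))"
proof -
  let ?H = "UNIV \<times> {0::real<..} :: (real \<times> real) set"
  have H: "upper_half_plane = ?H" by (auto simp: upper_half_plane_def)
  have fx: "((\<lambda>s. f (s, y)) has_derivative (*) (pderiv_x f (x, y))) (at x)"
    using f \<open>y > 0\<close> unfolding C1_on_def H
    by (fastforce simp: pderiv_x_def DERIV_deriv_iff_real_differentiable
        simp flip: has_field_derivative_def)
  have fy: "((\<lambda>t. f (s, t)) has_derivative blinfun_apply (blinfun_mult_right (pderiv_y f (s, t))))
      (at t within {0<..})" if "t \<in> {0<..}" for s t
  proof -
    have "((\<lambda>t. f (s, t)) has_real_derivative pderiv_y f (s, t)) (at t)"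
      using f that unfolding C1_on_def H
      by (fastforce simp: pderiv_y_def DERIV_deriv_iff_real_differentiable)
    then show ?thesis
      unfolding has_field_derivative_def
      by (simp add: has_derivative_at_withinI)
  qed
  have "continuous_on ?H (pderiv_y f)" using f unfolding C1_on_def H by simp
  then have "continuous_on ?H (\<lambda>p. blinfun_mult_right (pderiv_y f p))"
    by (rule bounded_linear.continuous_on[OF bounded_linear_blinfun_mult_right])
  then have cont: "continuous (at (x, y) within ?H)
      (\<lambda>(s, t). blinfun_mult_right (pderiv_y f (s, t)))"
    using \<open>y > 0\<close> by (simp add: continuous_on_eq_continuous_within split_def)
  have "((\<lambda>(s, t). f (s, t)) has_derivative
      (\<lambda>(u, v). pderiv_x f (x, y) * u + blinfun_mult_right (pderiv_y f (x, y)) v))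
      (at (x, y) within ?H)"
    by (rule has_derivative_partialsI[where fy = "\<lambda>s t. blinfun_mult_right (pderiv_y f (s, t))"])
      (use fx fy cont \<open>y > 0\<close> in simp_all)
  moreover have "at (x, y) within ?H = at (x, y)"
    by (rule at_within_open) (use \<open>y > 0\<close> in \<open>auto intro: open_Times\<close>)
  ultimately show ?thesis by (simp only: split_def prod.collapse blinfun_mult_right.rep_eq)
qed

lemma C1_on_chain_rule:
  assumes f: "C1_on upper_half_plane f"
    and u: "(u has_real_derivative u') (at s)" and v: "(v has_real_derivative v') (at s)"
    and "v s > 0"
  shows "((\<lambda>s. f (u s, v s)) has_real_derivative
    pderiv_x f (u s, v s) * u' + pderiv_y f (u s, v s) * v') (at s)"
proof -
  have "((\<lambda>s. (u s, v s)) has_derivative (\<lambda>h. (u' * h, v' * h))) (at s)"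
    using u v unfolding has_field_derivative_def by (rule has_derivative_Pair)
  from diff_chain_at[OF this C1_on_has_derivative[OF f \<open>v s > 0\<close>]]
  have "((\<lambda>s. f (u s, v s)) has_derivative
      (\<lambda>h. pderiv_x f (u s, v s) * (u' * h) + pderiv_y f (u s, v s) * (v' * h))) (at s)"
    by (simp add: o_def)
  moreover have "(\<lambda>h. pderiv_x f (u s, v s) * (u' * h) + pderiv_y f (u s, v s) * (v' * h)) =
      (*) (pderiv_x f (u s, v s) * u' + pderiv_y f (u s, v s) * v')"
    by (simp add: fun_eq_iff algebra_simps)
  ultimately show ?thesis by (simp add: has_field_derivative_def)
qed

text \<open>Polar coordinates in which the angle \<open>\<theta>\<close> is replaced by \<open>t = cos \<theta>\<close>. This turns the angular
  part \<open>\<phi>\<^sub>\<theta>\<^sub>\<theta> - cot \<theta> \<phi>\<^sub>\<theta>\<close> of the operator into \<open>(1 - t\<^sup>2) \<phi>\<^sub>t\<^sub>t\<close>.\<close>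
definition polar :: "real \<Rightarrow> real \<Rightarrow> real \<times> real" where
  "polar r t = (r * t, r * sqrt (1 - t\<^sup>2))"

lemma polar_in_upper_half_plane: "0 < r \<Longrightarrow> \<bar>t\<bar> < 1 \<Longrightarrow> polar r t \<in> upper_half_plane"
  by (simp add: polar_def upper_half_plane_def abs_square_less_1)

lemma continuous_on_polar [continuous_intros]:
  assumes "continuous_on S f" "continuous_on S g"
  shows "continuous_on S (\<lambda>p. polar (f p) (g p))"
  unfolding polar_def by (intro continuous_intros assms)

lemma C1_on_polar_r:
  assumes "C1_on upper_half_plane f" "0 < r" "\<bar>t\<bar> < 1"
  shows "((\<lambda>r. f (polar r t)) has_real_derivative
    pderiv_x f (polar r t) * t + pderiv_y f (polar r t) * sqrt (1 - t\<^sup>2)) (at r)"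
  unfolding polar_def
  by (rule C1_on_chain_rule[OF assms(1)])
    (use assms in \<open>auto intro!: derivative_eq_intros simp: abs_square_less_1\<close>)

lemma has_derivative_sqrt_one_minus_square:
  assumes "\<bar>t\<bar> < (1::real)"
  shows "((\<lambda>t. sqrt (1 - t\<^sup>2)) has_real_derivative - t / sqrt (1 - t\<^sup>2)) (at t)"
proof -
  have "1 - t\<^sup>2 > 0" using assms by (simp add: abs_square_less_1)
  then show ?thesis by (auto intro!: derivative_eq_intros simp: field_simps)
qed

lemma C1_on_polar_t:
  assumes "C1_on upper_half_plane f" "0 < r" "\<bar>t\<bar> < 1"
  shows "((\<lambda>t. f (polar r t)) has_real_derivative
    pderiv_x f (polar r t) * r - pderiv_y f (polar r t) * (r * t / sqrt (1 - t\<^sup>2))) (at t)"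
proof -
  have "((\<lambda>t. f (r * t, r * sqrt (1 - t\<^sup>2))) has_real_derivative
    pderiv_x f (r * t, r * sqrt (1 - t\<^sup>2)) * r +
    pderiv_y f (r * t, r * sqrt (1 - t\<^sup>2)) * (r * (- t / sqrt (1 - t\<^sup>2)))) (at t)"
  proof (rule C1_on_chain_rule[OF assms(1)])
    show "((\<lambda>t. r * sqrt (1 - t\<^sup>2)) has_real_derivative r * (- t / sqrt (1 - t\<^sup>2))) (at t)"
      by (intro DERIV_cmult has_derivative_sqrt_one_minus_square assms)
  qed (use assms in \<open>auto intro!: derivative_eq_intros simp: abs_square_less_1\<close>)
  then show ?thesis by (simp add: polar_def)
qed

definition polar_r :: "(real \<times> real \<Rightarrow> real) \<Rightarrow> real \<Rightarrow> real \<Rightarrow> real" where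
  "polar_r f r t = pderiv_x f (polar r t) * t + pderiv_y f (polar r t) * sqrt (1 - t\<^sup>2)"

text \<open>The factors \<open>t\<close> and \<open>sqrt (1 - t\<^sup>2)\<close> in
  \<open>polar_r\<close> do not depend on \<open>r\<close>, so a second radial derivative falls on
  the two partial derivatives alone.\<close>

definition polar_rr :: "(real \<times> real \<Rightarrow> real) \<Rightarrow> real \<Rightarrow> real \<Rightarrow> real" where
  "polar_rr f r t = polar_r (pderiv_x f) r t * t + polar_r (pderiv_y f) r t * sqrt (1 - t\<^sup>2)"

definition polar_t :: "(real \<times> real \<Rightarrow> real) \<Rightarrow> real \<Rightarrow> real \<Rightarrow> real" where
  "polar_t f r t = pderiv_x f (polar r t) * r - pderiv_y f (polar r t) * (r * t / sqrt (1 - t\<^sup>2))"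

text \<open>Differentiating \<open>r * t / sqrt (1 - t\<^sup>2)\<close> leaves a first-order term
  with \<open>pderiv_y f\<close>. The equation trades it for second derivatives, and together they
  form the radial one.\<close>

lemma polar_equation:
  assumes f: "C2_on upper_half_plane f"
    and eq: "\<And>x y. y > 0 \<Longrightarrow>
      y * (pderiv_x (pderiv_x f) (x, y) + pderiv_y (pderiv_y f) (x, y)) - pderiv_y f (x, y) = 0"
    and r: "0 < r" and t: "\<bar>t\<bar> < 1"
  shows "(polar_t f r has_real_derivative - r\<^sup>2 / (1 - t\<^sup>2) * polar_rr f r t) (at t)"
proof -
  define s where "s = sqrt (1 - t\<^sup>2)"
  have s: "s > 0" "s\<^sup>2 = 1 - t\<^sup>2" using t by (auto simp: s_def abs_square_less_1 abs_square_le_1)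
  have fx: "C1_on upper_half_plane (pderiv_x f)" and fy: "C1_on upper_half_plane (pderiv_y f)"
    using f by (auto simp: C2_on_def)
  have q: "((\<lambda>t. r * t / sqrt (1 - t\<^sup>2)) has_real_derivative r / s ^ 3) (at t)"
  proof -
    have "((\<lambda>t. r * t / sqrt (1 - t\<^sup>2)) has_real_derivative
        (r * s - r * t * (- t / s)) / (s * s)) (at t)"
      unfolding s_def
      by (rule DERIV_divide[OF _ has_derivative_sqrt_one_minus_square[OF t]])
        (use s in \<open>auto intro!: derivative_eq_intros simp: s_def\<close>)
    also have "(r * s - r * t * (- t / s)) / (s * s) = r * (s\<^sup>2 + t\<^sup>2) / s ^ 3"
      using s(1) by (simp add: field_simps power2_eq_square power3_eq_cube)
    finally show ?thesis using s(2) by simp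
  qed
  define X Y XX XY YX YY where
    "X = pderiv_x f (polar r t)" and "Y = pderiv_y f (polar r t)" and
    "XX = pderiv_x (pderiv_x f) (polar r t)" and "XY = pderiv_y (pderiv_x f) (polar r t)" and
    "YX = pderiv_x (pderiv_y f) (polar r t)" and "YY = pderiv_y (pderiv_y f) (polar r t)"
  note defs = X_def Y_def XX_def XY_def YX_def YY_def
  have pde: "Y = r * s * (XX + YY)"
    using eq[of "r * s" "r * t"] r s by (simp add: defs polar_def s_def)
  have "(polar_t f r has_real_derivative
      (XX * r - XY * (r * t / s)) * r -
      ((YX * r - YY * (r * t / s)) * (r * t / s) + Y * (r / s ^ 3))) (at t)"
    using DERIV_diff[OF DERIV_cmult_right[OF C1_on_polar_t[OF fx r t], of r]
      DERIV_mult[OF C1_on_polar_t[OF fy r t] q]]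
    unfolding polar_t_def[abs_def] defs s_def by (simp add: mult.commute)
  also have "(XX * r - XY * (r * t / s)) * r -
      ((YX * r - YY * (r * t / s)) * (r * t / s) + Y * (r / s ^ 3)) =
      - r\<^sup>2 / s\<^sup>2 * ((XX * t + XY * s) * t + (YX * t + YY * s) * s)"
  proof -
    \<comment> \<open>In terms of \<open>T\<close>, the factor \<open>1 / s\<^sup>2\<close> is 1 +
      T^2, and both sides become polynomials.\<close>
    define T where "T = t / s"
    have t_eq: "t = T * s" and T: "r * t / s = r * T" using s(1) by (auto simp: T_def)
    have "1 / s\<^sup>2 = (s\<^sup>2 + t\<^sup>2) / s\<^sup>2" by (simp add: s(2))
    also have "\<dots> = 1 + T\<^sup>2" using s(1) by (simp add: T_def add_divide_distrib power_divide)
    finally have s2: "1 / s\<^sup>2 = 1 + T\<^sup>2" .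
    have "Y * (r / s ^ 3) = r\<^sup>2 * (XX + YY) * (1 / s\<^sup>2)"
      unfolding pde using s(1) by (simp add: power2_eq_square power3_eq_cube)
    moreover have "- r\<^sup>2 / s\<^sup>2 * ((XX * t + XY * s) * t + (YX * t + YY * s) * s) =
        - r\<^sup>2 * ((XX * T + XY) * T + (YX * T + YY))"
      unfolding t_eq using s(1) by (simp add: divide_simps) (simp add: algebra_simps power2_eq_square)
    ultimately show ?thesis
      unfolding T s2 by (simp add: algebra_simps power2_eq_square)
  qed
  finally show ?thesis
    unfolding polar_rr_def polar_r_def by (simp add: defs s_def[symmetric] s(2))
qed

section \<open>Cut-off moments\<close>

definition moment :: "(real \<times> real \<Rightarrow> real) \<Rightarrow> nat \<Rightarrow> real \<Rightarrow> real" where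
  "moment f n r = integral {-1..1} (\<lambda>t. f (polar r t) * t ^ n)"

text \<open>\<open>t ^ n\<close>, cut off so that the test function \<open>(1 - t\<^sup>2) * cutoff n h t\<close> vanishes to second order
  where \<open>t\<^sup>2 = 1 - h\<close>.\<close>
definition cutoff :: "nat \<Rightarrow> real \<Rightarrow> real \<Rightarrow> real" where
  "cutoff n h t = t ^ n * (1 - h / (1 - t\<^sup>2))\<^sup>2"

text \<open>With s = 1 - t^2 this is t^n s (1 - h / s)^2 multiplied out, which separates (1 - t^2)
  t^n, the test function without cut-off, from the terms carrying \<open>h\<close>.\<close>

definition test_fun :: "nat \<Rightarrow> real \<Rightarrow> real \<Rightarrow> real" where
  "test_fun n h t = t ^ n * (1 - t\<^sup>2 - 2 * h + h\<^sup>2 / (1 - t\<^sup>2))"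

definition test_fun' :: "nat \<Rightarrow> real \<Rightarrow> real \<Rightarrow> real" where
  "test_fun' n h t = real n * t ^ (n - 1) * (1 - t\<^sup>2 - 2 * h + h\<^sup>2 / (1 - t\<^sup>2)) +
    t ^ n * (2 * h\<^sup>2 * t / (1 - t\<^sup>2)\<^sup>2 - 2 * t)"

text \<open>What the cut-off adds to the second derivative of (1 - t^2) t^n. The exponent
  \<open>n - 2\<close> is truncated only where its coefficient n (n - 1) is 0.\<close>

definition cutoff_error :: "nat \<Rightarrow> real \<Rightarrow> real \<Rightarrow> real" where
  "cutoff_error n h t = real (n * (n - 1)) * t ^ (n - 2) * (h\<^sup>2 / (1 - t\<^sup>2) - 2 * h) +
    t ^ n * (real (4 * n + 2) * h\<^sup>2 / (1 - t\<^sup>2)\<^sup>2 + 8 * h\<^sup>2 * t\<^sup>2 / (1 - t\<^sup>2) ^ 3)"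

lemma one_minus_square_pos: "\<bar>t\<bar> < (1::real) \<Longrightarrow> 0 < 1 - t\<^sup>2"
  by (simp add: abs_square_less_1)

lemma test_fun_eq_cutoff: "\<bar>t\<bar> < 1 \<Longrightarrow> test_fun n h t = (1 - t\<^sup>2) * cutoff n h t"
proof -
  have "s - 2 * h + h\<^sup>2 / s = s * (1 - h / s)\<^sup>2" if "s > 0" for s :: real
    using that by (simp add: power2_eq_square field_simps)
  then show "\<bar>t\<bar> < 1 \<Longrightarrow> test_fun n h t = (1 - t\<^sup>2) * cutoff n h t"
    using one_minus_square_pos[of t] by (simp add: test_fun_def cutoff_def)
qed

lemma test_fun_deriv:
  assumes "\<bar>t\<bar> < 1"
  shows "(test_fun n h has_real_derivative test_fun' n h t) (at t)"
  unfolding test_fun_def test_fun'_def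
  using one_minus_square_pos[OF assms]
  by (auto intro!: derivative_eq_intros simp: power2_eq_square)

text \<open>Without \<open>h\<close>, the coefficient of t^n collects - n (n - 1) - 4 n - 2 = - (n +
  1) (n + 2).\<close>

lemma test_fun'_deriv:
  assumes "\<bar>t\<bar> < 1"
  shows "(test_fun' n h has_real_derivative
    real (n * (n - 1)) * t ^ (n - 2) - real ((n + 1) * (n + 2)) * t ^ n + cutoff_error n h t) (at t)"
proof -
  define s where "s = 1 - t\<^sup>2"
  have s: "s > 0" using one_minus_square_pos[OF assms] by (simp add: s_def)
  have "((\<lambda>t. 2 * h\<^sup>2 * t / (1 - t\<^sup>2)\<^sup>2 - 2 * t) has_real_derivative
      (2 * h\<^sup>2 * s\<^sup>2 - 2 * h\<^sup>2 * t * (2 * s * (- 2 * t))) / (s\<^sup>2 * s\<^sup>2) - 2) (at t)"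
    using s unfolding s_def by (auto intro!: derivative_eq_intros)
  also have "(2 * h\<^sup>2 * s\<^sup>2 - 2 * h\<^sup>2 * t * (2 * s * (- 2 * t))) / (s\<^sup>2 * s\<^sup>2) - 2 =
      2 * h\<^sup>2 / s\<^sup>2 + 8 * h\<^sup>2 * t\<^sup>2 / s ^ 3 - 2"
    using s by (simp add: field_simps power2_eq_square power3_eq_cube)
  finally have q: "((\<lambda>t. 2 * h\<^sup>2 * t / (1 - t\<^sup>2)\<^sup>2 - 2 * t) has_real_derivative
      2 * h\<^sup>2 / s\<^sup>2 + 8 * h\<^sup>2 * t\<^sup>2 / s ^ 3 - 2) (at t)" .
  have p: "((\<lambda>t. 1 - t\<^sup>2 - 2 * h + h\<^sup>2 / (1 - t\<^sup>2)) has_real_derivative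
      2 * h\<^sup>2 * t / s\<^sup>2 - 2 * t) (at t)"
    using s unfolding s_def
    by (auto intro!: derivative_eq_intros simp: power2_eq_square)
  have m: "real n * t ^ (n - 1) * t = real n * t ^ n" by (cases n) auto
  have n1: "real n * (real (n - 1) * t ^ (n - 1 - 1)) = real (n * (n - 1)) * t ^ (n - 2)"
    by (simp add: numeral_2_eq_2)
  have m2: "real (n * (n - 1)) * t ^ (n - 2) * t\<^sup>2 = real (n * (n - 1)) * t ^ n"
    by (cases n; cases "n - 1") (auto simp: power2_eq_square)
  have "(test_fun' n h has_real_derivative
      real n * (real (n - 1) * t ^ (n - 1 - 1)) * (s - 2 * h + h\<^sup>2 / s) +
      real n * t ^ (n - 1) * (2 * h\<^sup>2 * t / s\<^sup>2 - 2 * t) +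
      (real n * t ^ (n - 1) * (2 * h\<^sup>2 * t / s\<^sup>2 - 2 * t) +
      t ^ n * (2 * h\<^sup>2 / s\<^sup>2 + 8 * h\<^sup>2 * t\<^sup>2 / s ^ 3 - 2))) (at t)"
    unfolding test_fun'_def
    by (rule derivative_eq_intros p q refl)+ (simp_all add: s_def algebra_simps)
  also have "real n * t ^ (n - 1) * (2 * h\<^sup>2 * t / s\<^sup>2 - 2 * t) =
      real n * t ^ (n - 1) * t * (2 * h\<^sup>2 / s\<^sup>2 - 2)"
    by (simp add: algebra_simps)
  also have "real n * (real (n - 1) * t ^ (n - 1 - 1)) * (s - 2 * h + h\<^sup>2 / s) =
      real (n * (n - 1)) * t ^ (n - 2) - real (n * (n - 1)) * t ^ (n - 2) * t\<^sup>2 +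
      real (n * (n - 1)) * t ^ (n - 2) * (h\<^sup>2 / s - 2 * h)"
    unfolding n1 by (simp add: s_def algebra_simps)
  finally show ?thesis
    unfolding m m2 cutoff_error_def s_def[symmetric]
    by (rule DERIV_cong) (cases n; simp add: algebra_simps add_divide_distrib)
qed

text \<open>Since 0 < s <= 1 for s = 1 - t^2, lower powers of 1 / s are dominated by the third. With
  H = h^2 / s^3, the t^(n-2) part is at most n^2 (H + 2 h) and the t^n part at most (4 n + 2 + 8)
  H.\<close>

lemma cutoff_error_bound:
  assumes "\<bar>t\<bar> < 1" "0 < h"
  shows "\<bar>cutoff_error n h t\<bar> \<le> real (2 * n\<^sup>2 + 4 * n + 10) * (h + h\<^sup>2 / (1 - t\<^sup>2) ^ 3)"
proof -
  define s where "s = 1 - t\<^sup>2"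
  define H where "H = h\<^sup>2 / s ^ 3"
  have s: "0 < s" "s \<le> 1" using one_minus_square_pos[OF assms(1)] by (auto simp: s_def)
  have H: "0 \<le> H" "h\<^sup>2 / s \<le> H" "h\<^sup>2 / s\<^sup>2 \<le> H"
    unfolding H_def using s power_decreasing[of 1 3 s] power_decreasing[of 2 3 s]
    by (auto intro!: divide_left_mono)
  have tn: "\<bar>t ^ k\<bar> \<le> 1" for k using assms(1) by (simp add: power_abs power_le_one)
  have 1: "\<bar>real (n * (n - 1)) * t ^ (n - 2) * (h\<^sup>2 / s - 2 * h)\<bar> \<le> real (n * (n - 1)) * (H + 2 * h)"
  proof -
    have "\<bar>h\<^sup>2 / s - 2 * h\<bar> \<le> H + 2 * h"
      using H s assms(2) by (simp add: abs_le_iff) (smt (verit) divide_nonneg_pos zero_le_power2)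
    then have "\<bar>t ^ (n - 2)\<bar> * \<bar>h\<^sup>2 / s - 2 * h\<bar> \<le> 1 * (H + 2 * h)"
      by (intro mult_mono tn) auto
    then show ?thesis by (simp add: abs_mult mult.assoc mult_left_mono del: of_nat_mult)
  qed
  have 2: "\<bar>t ^ n * (real (4 * n + 2) * h\<^sup>2 / s\<^sup>2 + 8 * h\<^sup>2 * t\<^sup>2 / s ^ 3)\<bar> \<le> real (4 * n + 10) * H"
  proof -
    have "real (4 * n + 2) * h\<^sup>2 / s\<^sup>2 + 8 * h\<^sup>2 * t\<^sup>2 / s ^ 3
        = real (4 * n + 2) * (h\<^sup>2 / s\<^sup>2) + 8 * (H * t\<^sup>2)" by (simp add: H_def)
    also have "\<dots> \<le> real (4 * n + 2) * H + 8 * (H * 1)"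
      using H tn[of 2] by (intro add_mono mult_left_mono) auto
    finally have *: "real (4 * n + 2) * h\<^sup>2 / s\<^sup>2 + 8 * h\<^sup>2 * t\<^sup>2 / s ^ 3 \<le> real (4 * n + 10) * H"
      by (simp add: algebra_simps)
    have **: "0 \<le> real (4 * n + 2) * h\<^sup>2 / s\<^sup>2 + 8 * h\<^sup>2 * t\<^sup>2 / s ^ 3"
      using s by (intro add_nonneg_nonneg divide_nonneg_pos) auto
    have "\<bar>t ^ n\<bar> * \<bar>real (4 * n + 2) * h\<^sup>2 / s\<^sup>2 + 8 * h\<^sup>2 * t\<^sup>2 / s ^ 3\<bar>
        \<le> 1 * (real (4 * n + 10) * H)"
      using * ** by (intro mult_mono tn) auto
    then show ?thesis by (simp add: abs_mult)
  qed
  have "real (n * (n - 1)) \<le> real (n\<^sup>2)" by (simp only: of_nat_le_iff power2_eq_square) simp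
  then have 3: "real (n * (n - 1)) * (H + 2 * h) \<le> real (n\<^sup>2) * (H + 2 * h)"
    using H assms by (intro mult_right_mono) auto
  have "\<bar>cutoff_error n h t\<bar> \<le> real (n\<^sup>2) * (H + 2 * h) + real (4 * n + 10) * H"
    unfolding cutoff_error_def s_def[symmetric] using 1 2 3 abs_triangle_ineq by (smt (verit))
  also have "\<dots> \<le> real (2 * n\<^sup>2 + 4 * n + 10) * (h + H)"
    using H assms by (simp add: algebra_simps)
  finally show ?thesis by (simp add: H_def s_def)
qed

section \<open>The truncated interval, where 1 - t^2 >= h\<close>

context
  fixes h a :: real
  assumes h: "0 < h" "h < 1" and a_def: "a = sqrt (1 - h)"
begin

lemma cutoff_radius: "0 < a" "a < 1" "a\<^sup>2 = 1 - h"
  using h by (auto simp: a_def)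

lemma cutoff_interval:
  assumes "t \<in> {-a..a}"
  shows "\<bar>t\<bar> < 1" "h \<le> 1 - t\<^sup>2"
proof -
  have "\<bar>t\<bar> \<le> a" using assms by auto
  then show "\<bar>t\<bar> < 1" using cutoff_radius by simp
  from \<open>\<bar>t\<bar> \<le> a\<close> have "t\<^sup>2 \<le> a\<^sup>2" using power_mono[of "\<bar>t\<bar>" a 2] by simp
  then show "h \<le> 1 - t\<^sup>2" using cutoff_radius by simp
qed

text \<open>The double zero removes both boundary terms of the integration by parts, so no bound on
  the t-derivative of \<phi> near the boundary enters.\<close>

lemma test_fun_endpoints:
  assumes "t = a \<or> t = - a"
  shows "test_fun n h t = 0" "test_fun' n h t = 0"
proof -
  have "1 - t\<^sup>2 = h" using assms cutoff_radius by auto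
  then show "test_fun n h t = 0" "test_fun' n h t = 0"
    using h by (simp_all add: test_fun_def test_fun'_def power2_eq_square)
qed

lemma continuous_on_cutoff: "continuous_on {-a..a} (cutoff n h)"
  unfolding cutoff_def using cutoff_interval one_minus_square_pos
  by (intro continuous_intros) fastforce

lemma continuous_on_cutoff_error: "continuous_on {-a..a} (cutoff_error n h)"
  unfolding cutoff_error_def using cutoff_interval one_minus_square_pos
  by (intro continuous_intros) fastforce+

text \<open>The factor h^(-2) is the size of the integral of (1 - t^2)^(-3) up to a distance of
  order h from the ends. Thus k = \<epsilon> h^2 contributes 4 \<epsilon> for every h.\<close>

lemma cutoff_integral_bound:
  fixes g :: "real \<Rightarrow> real"
  assumes g: "continuous_on {-a..a} g" and k: "0 \<le> k" "0 \<le> c"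
    and bound: "\<And>t. t \<in> {-a..a} \<Longrightarrow> \<bar>g t\<bar> \<le> c + k / (1 - t\<^sup>2) ^ 3"
  shows "\<bar>integral {-a..a} g\<bar> \<le> 2 * c + 4 * k / h\<^sup>2"
proof -
  \<comment> \<open>A primitive of the majorant \<open>F'\<close>: one has 1 - t^2 >= 1 - t for t >=
    0, and 1 - t^2 >= 1 + t for t < 0.\<close>
  define F where "F t = c * t + k * (1 / (2 * (1 - t)\<^sup>2) - 1 / (2 * (1 + t)\<^sup>2))" for t :: real
  define F' where "F' t = c + k * (1 / (1 - t) ^ 3 + 1 / (1 + t) ^ 3)" for t :: real
  have inv: "((\<lambda>x. 1 / (2 * x\<^sup>2)) has_real_derivative - (1 / x ^ 3)) (at x)" if "x > 0" for x :: real
    using that by (auto intro!: derivative_eq_intros simp: field_simps power2_eq_square power3_eq_cube)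
  have int: "(F' has_integral F a - F (- a)) {-a..a}"
  proof (rule fundamental_theorem_of_calculus)
    show "- a \<le> a" using cutoff_radius by simp
    fix t assume "t \<in> {-a..a}"
    then have "1 - t > 0" "1 + t > 0" using cutoff_interval[of t] by auto
    then have d: "((\<lambda>t. 1 / (2 * (1 - t)\<^sup>2)) has_real_derivative - (1 / (1 - t) ^ 3) * - 1) (at t)"
      "((\<lambda>t. 1 / (2 * (1 + t)\<^sup>2)) has_real_derivative - (1 / (1 + t) ^ 3) * 1) (at t)"
      by - (rule DERIV_chain2[OF inv]; auto intro!: derivative_eq_intros)+
    have "(F has_real_derivative F' t) (at t)"
      using DERIV_add[OF DERIV_cmult_Id[of c] DERIV_cmult[OF DERIV_diff[OF d], of k]]
      unfolding F_def[abs_def] F'_def by simp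
    then show "(F has_vector_derivative F' t) (at t within {-a..a})"
      by (simp add: has_field_derivative_at_within has_real_derivative_iff_has_vector_derivative[symmetric])
  qed
  have "norm (integral {-a..a} g) \<le> integral {-a..a} F'"
  proof (rule integral_norm_bound_integral)
    show "g integrable_on {-a..a}" using g by (rule integrable_continuous_real)
    show "F' integrable_on {-a..a}" using int by blast
    fix t assume t: "t \<in> {-a..a}"
    have p: "1 - t > 0" "1 + t > 0" using cutoff_interval[OF t] by auto
    have "1 / (1 - t\<^sup>2) ^ 3 \<le> 1 / (1 - t) ^ 3 + 1 / (1 + t) ^ 3"
    proof (cases "t \<ge> 0")
      case True
      have "1 - t \<le> 1 - t\<^sup>2" using True p by (simp add: power2_eq_square mult_left_le)
      then have "1 / (1 - t\<^sup>2) ^ 3 \<le> 1 / (1 - t) ^ 3"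
        using p by (intro divide_left_mono power_mono mult_pos_pos zero_less_power) auto
      then show ?thesis using p by (smt (verit) divide_nonneg_nonneg zero_le_power)
    next
      case False
      have "- t * - t \<le> - t" using False p by (intro mult_left_le) auto
      then have "1 + t \<le> 1 - t\<^sup>2" by (simp add: power2_eq_square)
      then have "1 / (1 - t\<^sup>2) ^ 3 \<le> 1 / (1 + t) ^ 3"
        using p by (intro divide_left_mono power_mono mult_pos_pos zero_less_power) auto
      then show ?thesis using p by (smt (verit) divide_nonneg_nonneg zero_le_power)
    qed
    then have "k * (1 / (1 - t\<^sup>2) ^ 3) \<le> k * (1 / (1 - t) ^ 3 + 1 / (1 + t) ^ 3)"
      using k by (intro mult_left_mono) auto
    then show "norm (g t) \<le> F' t" using bound[OF t] by (simp add: F'_def)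
  qed
  also have "integral {-a..a} F' = F a - F (- a)" using int by blast
  also have "\<dots> = 2 * c * a + k * (1 / (1 - a)\<^sup>2 - 1 / (1 + a)\<^sup>2)"
    by (simp add: F_def algebra_simps)
  also have "\<dots> \<le> 2 * c * 1 + k * (4 / h\<^sup>2)"
  proof (intro add_mono mult_left_mono)
    \<comment> \<open>This keeps \<open>1 - a\<close> at least h / 2, whence 4 / h^2.\<close>
    have "a \<le> 1 - h / 2"
      unfolding a_def by (rule real_le_lsqrt) (use h in \<open>auto simp: power2_eq_square algebra_simps\<close>)
    then have "1 / (1 - a)\<^sup>2 \<le> 1 / (h / 2)\<^sup>2"
      using h by (intro divide_left_mono power_mono mult_pos_pos zero_less_power) auto
    also have "\<dots> = 4 / h\<^sup>2" by (simp add: power_divide)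
    finally show "1 / (1 - a)\<^sup>2 - 1 / (1 + a)\<^sup>2 \<le> 4 / h\<^sup>2"
      by (smt (verit) divide_nonneg_nonneg zero_le_power2)
  qed (use k cutoff_radius in auto)
  finally show ?thesis by (simp add: mult.commute)
qed

text \<open>General in \<open>F\<close> because it is applied twice, to \<phi> in polar coordinates
  and then to its radial derivative.\<close>

lemma cutoff_moment_deriv:
  fixes F F' :: "real \<Rightarrow> real \<Rightarrow> real"
  assumes "\<And>r t. 0 < r \<Longrightarrow> t \<in> {-a..a} \<Longrightarrow> ((\<lambda>r. F r t) has_real_derivative F' r t) (at r)"
    and F: "continuous_on ({0<..} \<times> {-a..a}) (\<lambda>(r, t). F r t)"
    and F': "continuous_on ({0<..} \<times> {-a..a}) (\<lambda>(r, t). F' r t)"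
    and "0 < r"
  shows "((\<lambda>r. integral {-a..a} (\<lambda>t. F r t * cutoff n h t)) has_real_derivative
    integral {-a..a} (\<lambda>t. F' r t * cutoff n h t)) (at r)"
proof -
  have cut: "continuous_on ({0<..} \<times> {-a..a}) (\<lambda>p. cutoff n h (snd p))"
    by (rule continuous_on_compose2[OF continuous_on_cutoff]) (auto intro!: continuous_intros)
  have "((\<lambda>r. integral (cbox (-a) a) (\<lambda>t. F r t * cutoff n h t)) has_real_derivative
    integral (cbox (-a) a) (\<lambda>t. F' r t * cutoff n h t)) (at r within {0<..})"
  proof (rule leibniz_rule_field_derivative)
    fix r t :: real assume "r \<in> {0<..}" "t \<in> cbox (-a) a"
    then show "((\<lambda>r. F r t * cutoff n h t) has_real_derivative F' r t * cutoff n h t)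
        (at r within {0<..})"
      by (auto intro!: derivative_eq_intros has_field_derivative_at_within[OF assms(1)])
  next
    fix r :: real assume "r \<in> {0<..}"
    then have "continuous_on {-a..a} (F r)"
      using continuous_on_compose2[OF F continuous_on_Pair[OF continuous_on_const continuous_on_id]]
      by auto
    then show "(\<lambda>t. F r t * cutoff n h t) integrable_on cbox (-a) a"
      by (auto intro!: integrable_continuous_real continuous_intros continuous_on_cutoff)
  next
    show "continuous_on ({0<..} \<times> cbox (-a) a) (\<lambda>(r, t). F' r t * cutoff n h t)"
      using continuous_on_mult[OF F' cut] by (simp add: case_prod_beta')
  qed (use \<open>0 < r\<close> in auto)
  then show ?thesis using \<open>0 < r\<close> by (simp add: at_within_open[of r "{0<..}"])
qed

lemma continuous_on_compose_polar:
  assumes "continuous_on upper_half_plane f"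
  shows "continuous_on ({0<..} \<times> {-a..a}) (\<lambda>(r, t). f (polar r t))"
  unfolding case_prod_beta'
  by (rule continuous_on_compose2[OF assms])
    (auto intro!: continuous_intros polar_in_upper_half_plane cutoff_interval(1))

lemma continuous_on_polar_r:
  assumes "C1_on upper_half_plane f"
  shows "continuous_on ({0<..} \<times> {-a..a}) (\<lambda>(r, t). polar_r f r t)"
  using continuous_on_compose_polar[of "pderiv_x f"] continuous_on_compose_polar[of "pderiv_y f"] assms
  unfolding polar_r_def case_prod_beta' C1_on_def
  by (intro continuous_intros) auto

lemma cutoff_moment_equation:
  assumes f: "C2_on upper_half_plane f"
    and eq: "\<And>x y. y > 0 \<Longrightarrow>
      y * (pderiv_x (pderiv_x f) (x, y) + pderiv_y (pderiv_y f) (x, y)) - pderiv_y f (x, y) = 0"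
    and r: "0 < r"
  shows "r\<^sup>2 * integral {-a..a} (\<lambda>t. polar_rr f r t * cutoff n h t) =
    - integral {-a..a} (\<lambda>t. f (polar r t) * (real (n * (n - 1)) * t ^ (n - 2) -
      real ((n + 1) * (n + 2)) * t ^ n + cutoff_error n h t))"
proof -
  define W'' where "W'' t = real (n * (n - 1)) * t ^ (n - 2) -
      real ((n + 1) * (n + 2)) * t ^ n + cutoff_error n h t" for t
  have C1: "C1_on upper_half_plane f" and fx: "C1_on upper_half_plane (pderiv_x f)"
    and fy: "C1_on upper_half_plane (pderiv_y f)" using f by (auto simp: C2_on_def)
  \<comment> \<open>The boundary form of Green's identity: for a test function w its t-derivative is
    f_tt w - f w''. The factor 1 - t^2 in w cancels the denominator in
    \<open>polar_equation\<close>.\<close>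
  define J where "J t = polar_t f r t * test_fun n h t - f (polar r t) * test_fun' n h t" for t
  have "((\<lambda>t. - r\<^sup>2 * (polar_rr f r t * cutoff n h t) - f (polar r t) * W'' t) has_integral J a - J (- a))
      {-a..a}"
  proof (rule fundamental_theorem_of_calculus)
    show "- a \<le> a" using cutoff_radius by simp
    fix t assume t: "t \<in> {-a..a}"
    note t1 = cutoff_interval(1)[OF t]
    have s: "1 - t\<^sup>2 > 0" using one_minus_square_pos[OF t1] .
    have "(J has_real_derivative
        (- r\<^sup>2 / (1 - t\<^sup>2) * polar_rr f r t * test_fun n h t + test_fun' n h t * polar_t f r t) -
        (polar_t f r t * test_fun' n h t + W'' t * f (polar r t))) (at t)"
      unfolding J_def W''_def
      using C1_on_polar_t[OF C1 r t1, folded polar_t_def]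
      by (intro DERIV_diff DERIV_mult polar_equation[OF f eq r t1] test_fun_deriv[OF t1]
        test_fun'_deriv[OF t1])
    then have "(J has_real_derivative
        - r\<^sup>2 * (polar_rr f r t * cutoff n h t) - f (polar r t) * W'' t) (at t)"
      unfolding test_fun_eq_cutoff[OF t1]
      by (rule DERIV_cong) (use s in \<open>simp add: field_simps\<close>)
    then show "(J has_vector_derivative
        - r\<^sup>2 * (polar_rr f r t * cutoff n h t) - f (polar r t) * W'' t) (at t within {-a..a})"
      by (simp add: has_field_derivative_at_within has_real_derivative_iff_has_vector_derivative[symmetric])
  qed
  moreover have "J a = 0" "J (- a) = 0" by (simp_all add: J_def test_fun_endpoints)
  ultimately have 0: "integral {-a..a}
      (\<lambda>t. - r\<^sup>2 * (polar_rr f r t * cutoff n h t) - f (polar r t) * W'' t) = 0"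
    by (simp add: integral_unique)
  have slice: "continuous_on {-a..a} (G r)"
    if "continuous_on ({0<..} \<times> {-a..a}) (\<lambda>(r, t). G r t)" for G :: "real \<Rightarrow> real \<Rightarrow> real"
    using continuous_on_compose2[OF that continuous_on_Pair[OF continuous_on_const continuous_on_id]] r
    by auto
  have "continuous_on {-a..a} (polar_rr f r)"
    unfolding polar_rr_def
    by (intro continuous_intros slice continuous_on_polar_r fx fy)
  then have 1: "(\<lambda>t. - r\<^sup>2 * (polar_rr f r t * cutoff n h t)) integrable_on {-a..a}"
    by (intro integrable_continuous_real continuous_intros continuous_on_cutoff)
  have 2: "(\<lambda>t. f (polar r t) * W'' t) integrable_on {-a..a}"
    unfolding W''_def
    by (intro integrable_continuous_real continuous_intros continuous_on_cutoff_error
        slice[of "\<lambda>r t. f (polar r t)"] continuous_on_compose_polar)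
      (use C1 in \<open>simp add: C1_on_def\<close>)
  show ?thesis
    using 0[unfolded integral_diff[OF 1 2] integral_mult_right]
    unfolding W''_def[symmetric] by simp
qed

end

section \<open>The moment equation\<close>

lemma polar_in_closed_upper_half_plane:
  "0 \<le> r \<Longrightarrow> \<bar>t\<bar> \<le> 1 \<Longrightarrow> polar r t \<in> closed_upper_half_plane"
  by (simp add: polar_def closed_upper_half_plane_def abs_square_le_1)

lemma continuous_on_closed_polar:
  assumes "continuous_on closed_upper_half_plane f"
  shows "continuous_on ({0..} \<times> {-1..1}) (\<lambda>(r, t). f (polar r t))"
  unfolding case_prod_beta'
  by (rule continuous_on_compose2[OF assms])
    (auto intro!: continuous_intros polar_in_closed_upper_half_plane)

lemma continuous_on_closed_polar_slice:
  assumes "continuous_on closed_upper_half_plane f" "0 \<le> r"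
  shows "continuous_on {-1..1} (\<lambda>t. f (polar r t))"
  by (rule continuous_on_compose2[OF assms(1)])
    (use assms(2) in \<open>auto intro!: continuous_intros polar_in_closed_upper_half_plane\<close>)

text \<open>The points with |f| >= \<epsilon> form a compact set that avoids t = -1 and t = 1, so
  |f| / (1 - t^2)^3 is bounded there; elsewhere \<epsilon> suffices. The exponent 3 matches the
  singularity in \<open>cutoff_error_bound\<close>. Continuity gives no rate of decay, hence the
  additive \<epsilon>.\<close>

lemma vanishing_boundary_bound:
  assumes f: "continuous_on closed_upper_half_plane f" and f0: "\<And>x. f (x, 0) = 0" and "0 < \<epsilon>"
  obtains D where "0 \<le> D"
    "\<And>r t. r \<in> {0..b} \<Longrightarrow> t \<in> {-1..1} \<Longrightarrow> \<bar>f (polar r t)\<bar> \<le> \<epsilon> + D * (1 - t\<^sup>2) ^ 3"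
proof -
  define g where "g p = \<bar>f (polar (fst p) (snd p))\<bar>" for p
  let ?K = "{0..b} \<times> {-1..1::real}"
  have g: "continuous_on ?K g"
    unfolding g_def
    by (intro continuous_intros, rule continuous_on_subset[OF
        continuous_on_closed_polar[OF f, unfolded case_prod_beta']]) auto
  define S where "S = {p \<in> ?K. \<epsilon> \<le> g p}"
  have "closed S"
    unfolding S_def
    by (rule continuous_on_closed_Collect_le[OF continuous_on_const g])
      (intro closed_Times closed_atLeastAtMost)
  then have "compact S"
    using compact_Int_closed[OF compact_Times[OF compact_Icc compact_Icc], of S 0 b "-1" 1]
    by (simp add: S_def Int_def Collect_mono_iff)
  have pos: "1 - (snd p)\<^sup>2 > 0" if "p \<in> S" for p
  proof (rule ccontr)
    assume "\<not> 1 - (snd p)\<^sup>2 > 0"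
    moreover have "\<bar>snd p\<bar> \<le> 1" using that by (auto simp: S_def)
    ultimately have "(snd p)\<^sup>2 = 1" using abs_square_le_1[of "snd p"] by linarith
    then have "g p = 0" by (simp add: g_def polar_def f0)
    then show False using that \<open>0 < \<epsilon>\<close> by (simp add: S_def)
  qed
  have "continuous_on S (\<lambda>p. g p / (1 - (snd p)\<^sup>2) ^ 3)"
    using pos by (intro continuous_intros continuous_on_subset[OF g]) (fastforce simp: S_def)+
  then have "bounded ((\<lambda>p. g p / (1 - (snd p)\<^sup>2) ^ 3) ` S)"
    using \<open>compact S\<close> by (intro compact_imp_bounded compact_continuous_image)
  then obtain D where D: "D > 0" "\<And>p. p \<in> S \<Longrightarrow> norm (g p / (1 - (snd p)\<^sup>2) ^ 3) \<le> D"
    unfolding bounded_pos by auto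
  show thesis
  proof (rule that[of D])
    show "0 \<le> D" using D by simp
    fix r t :: real assume rt: "r \<in> {0..b}" "t \<in> {-1..1}"
    have "\<bar>t\<bar> \<le> 1" using rt by auto
    then have t2: "0 \<le> (1 - t\<^sup>2) ^ 3" by (simp add: abs_square_le_1)
    show "\<bar>f (polar r t)\<bar> \<le> \<epsilon> + D * (1 - t\<^sup>2) ^ 3"
    proof (cases "(r, t) \<in> S")
      case True
      have "g (r, t) \<le> D * (1 - t\<^sup>2) ^ 3"
        using D(2)[OF True] pos[OF True] by (simp add: abs_le_iff pos_divide_le_eq)
      then show ?thesis using \<open>0 < \<epsilon>\<close> by (simp add: g_def)
    next
      case False
      then have "g (r, t) < \<epsilon>" using rt by (auto simp: S_def)
      then show ?thesis using mult_nonneg_nonneg[OF less_imp_le[OF D(1)] t2] by (simp add: g_def)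
    qed
  qed
qed

section \<open>Cut-off errors for one profile P on a half circle\<close>

context
  fixes h a \<epsilon> D :: real and P :: "real \<Rightarrow> real"
  assumes h: "0 < h" "h < 1" and a_def: "a = sqrt (1 - h)"
    and P: "continuous_on {-1..1} P" and \<epsilon>: "0 \<le> \<epsilon>" and D: "0 \<le> D"
    and bound: "\<And>t. t \<in> {-1..1} \<Longrightarrow> \<bar>P t\<bar> \<le> \<epsilon> + D * (1 - t\<^sup>2) ^ 3"
begin

private lemma inner: "t \<in> {-a..a} \<Longrightarrow> t \<in> {-1..1}" "{-a..a} \<subseteq> {-1..1}"
  using cutoff_radius[OF h a_def] by auto

private lemma P_inner: "continuous_on {-a..a} P"
  using P inner(2) by (rule continuous_on_subset)

private lemma power_le_1: "t \<in> {-1..1} \<Longrightarrow> \<bar>t ^ n\<bar> \<le> (1::real)"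
  by (simp add: power_abs power_le_one abs_le_iff)

text \<open>On the two end pieces 1 - t^2 <= h, so the integrand is at most \<epsilon> + D h^3 in
  size, and each piece is shorter than 1.\<close>

lemma moment_tail:
  "\<bar>integral {-1..1} (\<lambda>t. P t * t ^ n) - integral {-a..a} (\<lambda>t. P t * t ^ n)\<bar> \<le> 2 * (\<epsilon> + D * h)"
proof -
  let ?g = "\<lambda>t. P t * t ^ n"
  have a: "0 < a" "a < 1" "a\<^sup>2 = 1 - h" using cutoff_radius[OF h a_def] .
  have g: "continuous_on {-1..1} ?g" by (intro continuous_intros P)
  have int: "?g integrable_on {-1..1}" using g by (rule integrable_continuous_real)
  have 1: "integral {-1..1} ?g = integral {-1..-a} ?g + integral {-a..1} ?g"
    using a Henstock_Kurzweil_Integration.integral_combine[OF _ _ int, of "-a"] by simp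
  have 2: "integral {-a..1} ?g = integral {-a..a} ?g + integral {a..1} ?g"
    using a Henstock_Kurzweil_Integration.integral_combine[OF _ _ integrable_subinterval_real[OF int], of "-a" a 1] by simp
  have small: "norm (?g t) \<le> \<epsilon> + D * h" if "t \<in> {-1..1}" "a \<le> \<bar>t\<bar>" for t
  proof -
    have "a\<^sup>2 \<le> t\<^sup>2" using power_mono[OF that(2), of 2] a by simp
    then have "1 - t\<^sup>2 \<le> h" using a by simp
    moreover have "0 \<le> 1 - t\<^sup>2" using that(1) by (simp add: abs_square_le_1 abs_le_iff)
    ultimately have "(1 - t\<^sup>2) ^ 3 \<le> h ^ 3" by (intro power_mono)
    also have "\<dots> \<le> h" using h power_decreasing[of 1 3 h] by simp
    finally have "\<bar>P t\<bar> \<le> \<epsilon> + D * h"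
      using bound[OF that(1)] D by (smt (verit) mult_left_mono)
    then have "\<bar>P t\<bar> * \<bar>t ^ n\<bar> \<le> (\<epsilon> + D * h) * 1"
      using power_le_1[OF that(1)] by (intro mult_mono) auto
    then show ?thesis by (simp add: abs_mult)
  qed
  have eD: "0 \<le> \<epsilon> + D * h" using \<epsilon> D h by simp
  have "norm (integral {-1..-a} ?g) \<le> (\<epsilon> + D * h) * (- a - - 1)"
    using a by (intro integral_bound continuous_on_subset[OF g] small) auto
  also have "\<dots> \<le> (\<epsilon> + D * h) * 1" using a eD by (intro mult_left_mono) auto
  finally have 3: "norm (integral {-1..-a} ?g) \<le> \<epsilon> + D * h" by simp
  have "norm (integral {a..1} ?g) \<le> (\<epsilon> + D * h) * (1 - a)"
    using a by (intro integral_bound continuous_on_subset[OF g] small) auto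
  also have "\<dots> \<le> (\<epsilon> + D * h) * 1" using a eD by (intro mult_left_mono) auto
  finally have 4: "norm (integral {a..1} ?g) \<le> \<epsilon> + D * h" by simp
  show ?thesis using 1 2 3 4 by simp
qed

lemma moment_cutoff:
  "\<bar>integral {-a..a} (\<lambda>t. P t * cutoff n h t) - integral {-a..a} (\<lambda>t. P t * t ^ n)\<bar>
    \<le> 4 * (\<epsilon> + D * h)"
proof -
  have cont: "continuous_on {-a..a} (\<lambda>t. P t * (cutoff n h t - t ^ n))"
    by (intro continuous_intros P_inner continuous_on_cutoff[OF h a_def])
  have "integral {-a..a} (\<lambda>t. P t * cutoff n h t) - integral {-a..a} (\<lambda>t. P t * t ^ n) =
      integral {-a..a} (\<lambda>t. P t * (cutoff n h t - t ^ n))"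
    unfolding right_diff_distrib
    by (rule integral_diff[symmetric]; intro integrable_continuous_real continuous_intros P_inner
        continuous_on_cutoff[OF h a_def])
  also have "\<bar>\<dots>\<bar> \<le> 2 * (2 * (\<epsilon> + D * h)) + 4 * 0 / h\<^sup>2"
  proof (rule cutoff_integral_bound[OF h a_def cont])
    fix t assume t: "t \<in> {-a..a}"
    define s where "s = 1 - t\<^sup>2"
    have s: "h \<le> s" "s \<le> 1" "0 < s" using cutoff_interval(2)[OF h a_def t] h by (auto simp: s_def)
    \<comment> \<open>The cut-off factor differs from 1 by u (u - 2), at most 2 u in size. Against
      \<epsilon> it is enough that u <= 1, and against the term with \<open>D\<close> that s^3 u =
      s^2 h <= h.\<close>
    define u where "u = h / s"
    have u: "0 \<le> u" "u \<le> 1" "s ^ 3 * u \<le> h"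
    proof -
      have "s ^ 3 * u = s\<^sup>2 * h" using s by (simp add: u_def power2_eq_square power3_eq_cube)
      also have "\<dots> \<le> 1 * h" using s h by (intro mult_right_mono power_le_one) auto
      finally show "s ^ 3 * u \<le> h" by simp
    qed (use s h in \<open>auto simp: u_def\<close>)
    have "cutoff n h t - t ^ n = t ^ n * (u * (u - 2))"
      unfolding cutoff_def s_def[symmetric] u_def[symmetric]
      by (simp add: power2_eq_square algebra_simps)
    then have "\<bar>cutoff n h t - t ^ n\<bar> = \<bar>t ^ n\<bar> * \<bar>u * (u - 2)\<bar>"
      by (simp only: abs_mult)
    also have "\<bar>u * (u - 2)\<bar> = u * (2 - u)" using u by (simp add: abs_mult)
    also have "u * (2 - u) = 2 * u - u\<^sup>2" by (simp add: power2_eq_square algebra_simps)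
    also have "\<bar>t ^ n\<bar> * (2 * u - u\<^sup>2) \<le> 1 * (2 * u)"
      using u mult_right_mono[of u 2 u] power_le_1[OF inner(1)[OF t], of n]
      by (intro mult_mono) (auto simp: power2_eq_square)
    finally have "\<bar>P t\<bar> * \<bar>cutoff n h t - t ^ n\<bar> \<le> (\<epsilon> + D * s ^ 3) * (2 * u)"
      using bound[OF inner(1)[OF t]] u by (intro mult_mono) (auto simp: s_def)
    also have "\<dots> = 2 * (\<epsilon> * u + D * (s ^ 3 * u))" by (simp add: algebra_simps)
    also have "\<dots> \<le> 2 * (\<epsilon> * 1 + D * h)"
      using u \<epsilon> D by (intro mult_left_mono add_mono) auto
    finally show "\<bar>P t * (cutoff n h t - t ^ n)\<bar> \<le> 2 * (\<epsilon> + D * h) + 0 / (1 - t\<^sup>2) ^ 3"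
      by (simp add: abs_mult)
  qed (use \<epsilon> D h in auto)
  finally show ?thesis by simp
qed

text \<open>The singular part h^2 / s^3 of the error meets D s^3 as D h^2, and meets \<epsilon> as
  \<epsilon> h^2 / s^3, whose integral is at most 4 \<epsilon>. The regular part adds at most 2
  \<epsilon>, which makes 6.\<close>

lemma moment_cutoff_error:
  "\<bar>integral {-a..a} (\<lambda>t. P t * cutoff_error n h t)\<bar>
    \<le> 6 * real (2 * n\<^sup>2 + 4 * n + 10) * (\<epsilon> + D * h)"
proof -
  define c where "c = real (2 * n\<^sup>2 + 4 * n + 10)"
  have c: "c \<ge> 0" by (simp add: c_def)
  have "\<bar>integral {-a..a} (\<lambda>t. P t * cutoff_error n h t)\<bar>
      \<le> 2 * (c * (\<epsilon> * h + D * h + D * h\<^sup>2)) + 4 * (c * \<epsilon> * h\<^sup>2) / h\<^sup>2"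
  proof (rule cutoff_integral_bound[OF h a_def])
    show "continuous_on {-a..a} (\<lambda>t. P t * cutoff_error n h t)"
      by (intro continuous_intros P_inner continuous_on_cutoff_error[OF h a_def])
    fix t assume t: "t \<in> {-a..a}"
    define s where "s = 1 - t\<^sup>2"
    have s: "s \<le> 1" "0 < s" using cutoff_interval(2)[OF h a_def t] h by (auto simp: s_def)
    have "\<bar>P t\<bar> * \<bar>cutoff_error n h t\<bar> \<le> (\<epsilon> + D * s ^ 3) * (c * (h + h\<^sup>2 / s ^ 3))"
      unfolding c_def s_def
      using bound[OF inner(1)[OF t]] cutoff_error_bound[OF cutoff_interval(1)[OF h a_def t] h(1)]
      by (intro mult_mono) auto
    also have "\<dots> = c * (\<epsilon> * h + D * (s ^ 3 * h) + D * h\<^sup>2) + c * \<epsilon> * h\<^sup>2 / s ^ 3"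
      using s by (simp add: field_simps)
    also have "\<dots> \<le> c * (\<epsilon> * h + D * (1 * h) + D * h\<^sup>2) + c * \<epsilon> * h\<^sup>2 / s ^ 3"
      using s h c D by (intro add_mono mult_left_mono mult_right_mono power_le_one) auto
    finally show "\<bar>P t * cutoff_error n h t\<bar> \<le>
        c * (\<epsilon> * h + D * h + D * h\<^sup>2) + c * \<epsilon> * h\<^sup>2 / (1 - t\<^sup>2) ^ 3"
      by (simp add: abs_mult s_def)
  qed (use c \<epsilon> D h in auto)
  also have "\<dots> = c * (2 * (\<epsilon> * h + D * h + D * h\<^sup>2) + 4 * \<epsilon>)"
    using h by (simp add: algebra_simps)
  also have "\<dots> \<le> c * (6 * (\<epsilon> + D * h))"
  proof (rule mult_left_mono[OF _ c])
    have "\<epsilon> * h \<le> \<epsilon> * 1" using \<epsilon> h by (intro mult_left_mono) auto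
    moreover have "D * h\<^sup>2 \<le> D * h" using D h by (intro mult_left_mono) (auto simp: power2_eq_square)
    moreover have "0 \<le> D * h" using D h by simp
    ultimately show "2 * (\<epsilon> * h + D * h + D * h\<^sup>2) + 4 * \<epsilon> \<le> 6 * (\<epsilon> + D * h)" by simp
  qed
  finally show ?thesis by (simp add: c_def algebra_simps)
qed

end

lemma weak_ode_moment:
  assumes f: "continuous_on closed_upper_half_plane f" and f0: "\<And>x. f (x, 0) = 0"
    and C2: "C2_on upper_half_plane f"
    and eq: "\<And>x y. y > 0 \<Longrightarrow>
      y * (pderiv_x (pderiv_x f) (x, y) + pderiv_y (pderiv_y f) (x, y)) - pderiv_y f (x, y) = 0"
  shows "weak_ode (\<lambda>r. real ((n + 1) * (n + 2)) * moment f n r - real (n * (n - 1)) * moment f (n - 2) r)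
    (moment f n)"
  unfolding weak_ode_def
proof (intro allI impI)
  fix r1 r2 e :: real assume r12: "0 < r1" "r1 < r2" and e: "0 < e"
  define L M c where "L = real ((n + 1) * (n + 2))" and "M = real (n * (n - 1))"
    and "c = real (2 * n\<^sup>2 + 4 * n + 10)"
  have nonneg: "0 \<le> L" "0 \<le> M" "0 \<le> c" by (simp_all add: L_def M_def c_def)
  \<comment> \<open>\<open>6\<close> covers the distance of the approximant to the moment, 2 from
    \<open>moment_tail\<close> and 4 from \<open>moment_cutoff\<close>. The rest covers the
    right-hand side: \<open>moment_tail\<close> for two moments and
    \<open>moment_cutoff_error\<close>.\<close>
  define K where "K = 6 + 2 * L + 2 * M + 6 * c"
  have K: "K > 0" using nonneg by (simp add: K_def)
  define \<epsilon> where "\<epsilon> = e / (2 * K)"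
  have \<epsilon>: "\<epsilon> > 0" using e K by (simp add: \<epsilon>_def)
  obtain D where D: "0 \<le> D"
    "\<And>r t. r \<in> {0..r2} \<Longrightarrow> t \<in> {-1..1} \<Longrightarrow> \<bar>f (polar r t)\<bar> \<le> \<epsilon> + D * (1 - t\<^sup>2) ^ 3"
    using vanishing_boundary_bound[OF f f0 \<epsilon>] by blast
  \<comment> \<open>Chosen after \<open>D\<close> so that D h <= \<epsilon>. All errors are then
    multiples of \<epsilon> + D h <= 2 \<epsilon>, which is the 2 in the choice of
    \<epsilon>.\<close>
  define h where "h = min (1 / 2) (\<epsilon> / (D + 1))"
  have h: "0 < h" "h < 1" using \<epsilon> D by (auto simp: h_def)
  have "D * h \<le> (D + 1) * (\<epsilon> / (D + 1))" using D h by (intro mult_mono) (auto simp: h_def)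
  then have Dh: "D * h \<le> \<epsilon>" using D by simp
  define a where "a = sqrt (1 - h)"
  have C1: "C1_on upper_half_plane f" "C1_on upper_half_plane (pderiv_x f)"
    "C1_on upper_half_plane (pderiv_y f)" using C2 by (auto simp: C2_on_def)
  define \<eta> where "\<eta> = \<epsilon> + D * h"
  have K\<eta>: "K * \<eta> \<le> e"
  proof -
    have "K * \<eta> \<le> K * (2 * \<epsilon>)" using Dh K by (intro mult_left_mono) (auto simp: \<eta>_def)
    also have "\<dots> = e" using K by (simp add: \<epsilon>_def)
    finally show ?thesis .
  qed
  have \<eta>: "\<eta> \<ge> 0" using \<epsilon> D h by (simp add: \<eta>_def)
  note ivl = cutoff_interval(1)[OF h a_def]
  let ?g = "\<lambda>r. integral {-a..a} (\<lambda>t. f (polar r t) * cutoff n h t)"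
  let ?g' = "\<lambda>r. integral {-a..a} (\<lambda>t. polar_r f r t * cutoff n h t)"
  let ?g'' = "\<lambda>r. integral {-a..a} (\<lambda>t. polar_rr f r t * cutoff n h t)"
  show "\<exists>g g' g''. \<forall>r\<in>{r1..r2}.
        (g has_real_derivative g' r) (at r) \<and> (g' has_real_derivative g'' r) (at r) \<and>
        \<bar>g r - moment f n r\<bar> \<le> e \<and>
        \<bar>r\<^sup>2 * g'' r - (real ((n + 1) * (n + 2)) * moment f n r - real (n * (n - 1)) * moment f (n - 2) r)\<bar> \<le> e"
  proof (rule exI[of _ ?g], rule exI[of _ ?g'], rule exI[of _ ?g''], intro ballI conjI)
    fix r assume r: "r \<in> {r1..r2}"
    then have r0: "0 < r" using r12 by simp
    show "(?g has_real_derivative ?g' r) (at r)"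
    proof (rule cutoff_moment_deriv[OF h a_def _ _ _ r0])
      show "((\<lambda>r. f (polar r t)) has_real_derivative polar_r f r t) (at r)"
        if "0 < r" "t \<in> {-a..a}" for r t
        using C1_on_polar_r[OF C1(1) that(1) ivl[OF that(2)]] by (simp add: polar_r_def)
    qed (use C1 in \<open>auto intro!: continuous_on_compose_polar[OF h a_def]
        continuous_on_polar_r[OF h a_def] simp: C1_on_def\<close>)
    show "(?g' has_real_derivative ?g'' r) (at r)"
    proof (rule cutoff_moment_deriv[OF h a_def _ _ _ r0])
      show "((\<lambda>r. polar_r f r t) has_real_derivative polar_rr f r t) (at r)"
        if "0 < r" "t \<in> {-a..a}" for r t
        using DERIV_add[OF DERIV_cmult_right[OF C1_on_polar_r[OF C1(2) that(1) ivl[OF that(2)]], of t]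
            DERIV_cmult_right[OF C1_on_polar_r[OF C1(3) that(1) ivl[OF that(2)]], of "sqrt (1 - t\<^sup>2)"]]
        unfolding polar_rr_def polar_r_def .
      show "continuous_on ({0<..} \<times> {- a..a}) (\<lambda>(r, t). polar_rr f r t)"
        using continuous_on_polar_r[OF h a_def C1(2)] continuous_on_polar_r[OF h a_def C1(3)]
        unfolding polar_rr_def case_prod_beta' by (intro continuous_intros)
    qed (use C1 in \<open>auto intro!: continuous_on_polar_r[OF h a_def]\<close>)
    let ?P = "\<lambda>t. f (polar r t)"
    have P: "continuous_on {-1..1} ?P" using continuous_on_closed_polar_slice[OF f] r0 by simp
    have bd: "\<bar>?P t\<bar> \<le> \<epsilon> + D * (1 - t\<^sup>2) ^ 3" if "t \<in> {-1..1}" for t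
      using D(2)[OF _ that] r r0 by simp
    note est = h a_def P less_imp_le[OF \<epsilon>] D(1) bd
    let ?I = "\<lambda>k. integral {-a..a} (\<lambda>t. ?P t * t ^ k)"
    have tail: "\<bar>moment f k r - ?I k\<bar> \<le> 2 * \<eta>" for k
      using moment_tail[OF est] by (simp add: moment_def \<eta>_def)
    have "\<bar>?g r - ?I n\<bar> \<le> 4 * \<eta>" using moment_cutoff[OF est] by (simp add: \<eta>_def)
    then have "\<bar>?g r - moment f n r\<bar> \<le> 6 * \<eta>" using tail[of n] by linarith
    also have "\<dots> \<le> K * \<eta>" using \<eta> nonneg by (intro mult_right_mono) (auto simp: K_def)
    finally show "\<bar>?g r - moment f n r\<bar> \<le> e" using K\<eta> by simp
    let ?E = "integral {-a..a} (\<lambda>t. ?P t * cutoff_error n h t)"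
    have Pa: "continuous_on {-a..a} ?P"
      by (rule continuous_on_subset[OF P]) (use cutoff_radius[OF h a_def] in auto)
    have "((\<lambda>t. M * (?P t * t ^ (n - 2)) - L * (?P t * t ^ n) + ?P t * cutoff_error n h t)
        has_integral M * ?I (n - 2) - L * ?I n + ?E) {-a..a}"
      by (intro has_integral_add has_integral_diff has_integral_mult_right integrable_integral
          integrable_continuous_real continuous_intros Pa continuous_on_cutoff_error[OF h a_def])
    then have "integral {-a..a} (\<lambda>t. ?P t * (M * t ^ (n - 2) - L * t ^ n + cutoff_error n h t)) =
        M * ?I (n - 2) - L * ?I n + ?E"
      by (intro integral_unique) (simp add: algebra_simps)
    then have "r\<^sup>2 * ?g'' r = L * ?I n - M * ?I (n - 2) - ?E"
      using cutoff_moment_equation[OF h a_def C2 eq r0, of n] unfolding L_def M_def by simp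
    moreover have "\<bar>?E\<bar> \<le> 6 * c * \<eta>" using moment_cutoff_error[OF est] by (simp add: \<eta>_def c_def)
    moreover have "\<bar>L * moment f n r - L * ?I n\<bar> \<le> L * (2 * \<eta>)"
      using mult_left_mono[OF tail[of n] nonneg(1)] nonneg by (simp add: abs_mult flip: right_diff_distrib)
    moreover have "\<bar>M * moment f (n - 2) r - M * ?I (n - 2)\<bar> \<le> M * (2 * \<eta>)"
      using mult_left_mono[OF tail[of "n - 2"] nonneg(2)] nonneg
      by (simp add: abs_mult flip: right_diff_distrib)
    ultimately have "\<bar>r\<^sup>2 * ?g'' r - (L * moment f n r - M * moment f (n - 2) r)\<bar>
        \<le> L * (2 * \<eta>) + M * (2 * \<eta>) + 6 * c * \<eta>" by linarith
    also have "\<dots> \<le> K * \<eta>" using \<eta> by (simp add: K_def algebra_simps)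
    finally show "\<bar>r\<^sup>2 * ?g'' r - (real ((n + 1) * (n + 2)) * moment f n r -
        real (n * (n - 1)) * moment f (n - 2) r)\<bar> \<le> e"
      using K\<eta> unfolding L_def M_def by linarith
  qed
qed

section \<open>Uniqueness\<close>

lemma weak_ode_cong:
  assumes "weak_ode F d" "\<And>r. 0 < r \<Longrightarrow> F r = G r"
  shows "weak_ode G d"
  unfolding weak_ode_def
proof (intro allI impI)
  fix a b e :: real assume ab: "0 < a" "a < b" "0 < e"
  then obtain g g' g'' where g:
    "\<And>r. r \<in> {a..b} \<Longrightarrow> (g has_real_derivative g' r) (at r)"
    "\<And>r. r \<in> {a..b} \<Longrightarrow> (g' has_real_derivative g'' r) (at r)"
    "\<And>r. r \<in> {a..b} \<Longrightarrow> \<bar>g r - d r\<bar> \<le> e"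
    "\<And>r. r \<in> {a..b} \<Longrightarrow> \<bar>r\<^sup>2 * g'' r - F r\<bar> \<le> e"
    using weak_odeE[OF assms(1)] by metis
  show "\<exists>g g' g''. \<forall>r\<in>{a..b}. (g has_real_derivative g' r) (at r) \<and>
      (g' has_real_derivative g'' r) (at r) \<and> \<bar>g r - d r\<bar> \<le> e \<and> \<bar>r\<^sup>2 * g'' r - G r\<bar> \<le> e"
  proof (rule exI[of _ g], rule exI[of _ g'], rule exI[of _ g''], intro ballI conjI)
    fix r assume r: "r \<in> {a..b}"
    then have "F r = G r" using ab by (intro assms(2)) simp
    then show "\<bar>r\<^sup>2 * g'' r - G r\<bar> \<le> e" using g(4)[OF r] by simp
  qed (rule g; assumption)+
qed

text \<open>The barrier is applied to both \<open>d\<close> and \<open>- d\<close>, on intervals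
  whose boundary values have arbitrarily little influence at the fixed point
  \<open>r\<close>.\<close>

lemma weak_ode_zero:
  assumes d: "weak_ode (\<lambda>r. real ((n + 1) * (n + 2)) * d r) d"
    and small: "\<And>e. 0 < e \<Longrightarrow> \<exists>a b \<alpha> \<beta>. 0 < a \<and> a \<le> r \<and> r \<le> b \<and> a < b \<and> \<bar>d a\<bar> \<le> \<alpha> \<and> \<bar>d b\<bar> \<le> \<beta> \<and>
      \<alpha> * (a / r) ^ (n + 1) + \<beta> * (r / b) ^ (n + 2) \<le> e"
  shows "d r = 0"
proof -
  have "\<bar>d r\<bar> \<le> 0 + e" if e: "0 < e" for e
  proof -
    obtain a b \<alpha> \<beta> where ab: "0 < a" "a \<le> r" "r \<le> b" "a < b" "\<bar>d a\<bar> \<le> \<alpha>" "\<bar>d b\<bar> \<le> \<beta>"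
      "\<alpha> * (a / r) ^ (n + 1) + \<beta> * (r / b) ^ (n + 2) \<le> e" using small[OF e] by blast
    have "weak_ode (\<lambda>r. real ((n + 1) * (n + 2)) * - d r) (\<lambda>r. - d r)"
      using weak_ode_uminus[OF d] by simp
    from weak_ode_le_barrier[OF this ab(1-4), of \<alpha> \<beta>] weak_ode_le_barrier[OF d ab(1-4), of \<alpha> \<beta>] ab
    show ?thesis by (auto simp: abs_le_iff)
  qed
  then have "\<bar>d r\<bar> \<le> 0" by (rule field_le_epsilon)
  then show ?thesis by simp
qed

text \<open>The outer barrier term is of order b^2 (r / b)^(n+2), that is b^(-n), and tends to 0
  because n > 0. For n = 0 the function r^2 is a counterexample.\<close>

lemma weak_ode_zero_of_growth:
  assumes d: "weak_ode (\<lambda>r. real ((n + 1) * (n + 2)) * d r) d" and "0 < n"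
    and K: "\<And>s. 0 < s \<Longrightarrow> \<bar>d s\<bar> \<le> K * (1 + s\<^sup>2)" and "0 < r"
  shows "d r = 0"
proof (rule weak_ode_zero[OF d])
  fix e :: real assume e: "0 < e"
  have K0: "0 \<le> K" using K[of 1] by simp
  \<comment> \<open>From a <= 1 and b >= 1 the inner term is at most 2 K a / r and the outer one at
    most 2 K r^3 / b; the last entries of \<open>min\<close> and \<open>max\<close> make each at
    most e / 2. \<open>K + 1\<close> avoids division by 0, and \<open>2 * r\<close> ensures
    \<open>a < b\<close>.\<close>
  define a where "a = min (min 1 r) (e * r / (4 * (K + 1)))"
  define b where "b = max (max 1 (2 * r)) (4 * K * r ^ 3 / e)"
  have a: "0 < a" "a \<le> 1" "a \<le> r" "a \<le> e * r / (4 * (K + 1))"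
    using \<open>0 < r\<close> e K0 by (auto simp: a_def)
  have b: "1 \<le> b" "2 * r \<le> b" "4 * K * r ^ 3 / e \<le> b" by (auto simp: b_def)
  have "K * (1 + a\<^sup>2) * (a / r) ^ (n + 1) \<le> K * 2 * (a / r)"
  proof (intro mult_mono)
    show "(a / r) ^ (n + 1) \<le> a / r" using power_decreasing[of 1 "n + 1" "a / r"] a by simp
    show "1 + a\<^sup>2 \<le> 2" using a by (simp add: power_le_one)
  qed (use a K0 in auto)
  also have "\<dots> \<le> (K + 1) * 2 * (a / r)" using a by (intro mult_right_mono) auto
  also have "\<dots> \<le> e / 2" using a \<open>0 < r\<close> K0 by (simp add: field_simps)
  finally have 1: "K * (1 + a\<^sup>2) * (a / r) ^ (n + 1) \<le> e / 2" .
  have "K * (1 + b\<^sup>2) * (r / b) ^ (n + 2) \<le> K * (2 * b\<^sup>2) * (r / b) ^ 3"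
  proof (intro mult_mono)
    show "(r / b) ^ (n + 2) \<le> (r / b) ^ 3"
      using b \<open>0 < r\<close> \<open>0 < n\<close> by (intro power_decreasing) auto
    show "1 + b\<^sup>2 \<le> 2 * b\<^sup>2" using b by (simp add: one_le_power)
  qed (use b \<open>0 < r\<close> K0 in auto)
  also have "\<dots> = 2 * K * r ^ 3 / b" using b by (simp add: field_simps power2_eq_square power3_eq_cube)
  also have "\<dots> \<le> e / 2" using b e by (simp add: field_simps)
  finally have 2: "K * (1 + b\<^sup>2) * (r / b) ^ (n + 2) \<le> e / 2" .
  have "\<bar>d a\<bar> \<le> K * (1 + a\<^sup>2)" "\<bar>d b\<bar> \<le> K * (1 + b\<^sup>2)" using K a b by auto
  moreover have "r \<le> b" "a < b" using a b \<open>0 < r\<close> by auto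
  moreover have "K * (1 + a\<^sup>2) * (a / r) ^ (n + 1) + K * (1 + b\<^sup>2) * (r / b) ^ (n + 2) \<le> e"
    using 1 2 by linarith
  ultimately show "\<exists>a b \<alpha> \<beta>. 0 < a \<and> a \<le> r \<and> r \<le> b \<and> a < b \<and> \<bar>d a\<bar> \<le> \<alpha> \<and> \<bar>d b\<bar> \<le> \<beta> \<and>
      \<alpha> * (a / r) ^ (n + 1) + \<beta> * (r / b) ^ (n + 2) \<le> e"
    using a(1,3)
    by - (intro exI[of _ a] exI[of _ b] exI[of _ "K * (1 + a\<^sup>2)"] exI[of _ "K * (1 + b\<^sup>2)"] conjI)
qed

text \<open>\<open>g\<close> is orthogonal to all polynomials and is itself a uniform limit of
  polynomials, so the integral of g^2 is 0.\<close>

lemma zero_of_moments_zero: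
  fixes g :: "real \<Rightarrow> real"
  assumes g: "continuous_on {-1..1} g"
    and mom: "\<And>n. integral {-1..1} (\<lambda>t. g t * t ^ n) = 0" and t: "t \<in> {-1..1}"
  shows "g t = 0"
proof -
  define N where "N = integral {-1..1} (\<lambda>t. \<bar>g t\<bar>)"
  have N: "N \<ge> 0" unfolding N_def by (rule integral_nonneg)
    (auto intro!: integrable_continuous_real continuous_intros g)
  have "integral {-1..1} (\<lambda>t. g t * g t) \<le> 0 + e" if "0 < e" for e
  proof -
    define e' where "e' = e / (N + 1)"
    have e': "0 < e'" using that N by (simp add: e'_def)
    obtain p where p: "real_polynomial_function p" "\<And>t. t \<in> {-1..1} \<Longrightarrow> \<bar>g t - p t\<bar> < e'"
      using Stone_Weierstrass_real_polynomial_function[OF compact_Icc g e'] by blast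
    obtain c k where ck: "p = (\<lambda>x. \<Sum>i\<le>k. c i * x ^ i)"
      using p(1) real_polynomial_function_iff_sum by blast
    have pc: "continuous_on {-1..1} p" unfolding ck by (intro continuous_intros)
    have "integral {-1..1} (\<lambda>t. g t * p t) = integral {-1..1} (\<lambda>t. \<Sum>i\<le>k. c i * (g t * t ^ i))"
      by (simp add: ck sum_distrib_left algebra_simps)
    also have "\<dots> = (\<Sum>i\<le>k. integral {-1..1} (\<lambda>t. c i * (g t * t ^ i)))"
      by (intro integral_sum integrable_continuous_real continuous_intros g) auto
    also have "\<dots> = 0" by (simp add: mom)
    finally have gp: "integral {-1..1} (\<lambda>t. g t * p t) = 0" .
    have "integral {-1..1} (\<lambda>t. g t * g t) =
        integral {-1..1} (\<lambda>t. g t * g t) - integral {-1..1} (\<lambda>t. g t * p t)"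
      by (simp add: gp)
    also have "\<dots> = integral {-1..1} (\<lambda>t. g t * g t - g t * p t)"
      by (intro integral_diff[symmetric] integrable_continuous_real continuous_intros g pc)
    also have "\<dots> \<le> integral {-1..1} (\<lambda>t. e' * \<bar>g t\<bar>)"
    proof (intro integral_le integrable_continuous_real continuous_intros g pc)
      fix t :: real assume "t \<in> {-1..1}"
      have "g t * g t - g t * p t = g t * (g t - p t)" by (simp add: algebra_simps)
      also have "\<dots> \<le> \<bar>g t\<bar> * \<bar>g t - p t\<bar>" by (simp flip: abs_mult)
      also have "\<dots> \<le> \<bar>g t\<bar> * e'"
        using p(2)[OF \<open>t \<in> {-1..1}\<close>] by (intro mult_left_mono) auto
      finally show "g t * g t - g t * p t \<le> e' * \<bar>g t\<bar>" by (simp add: mult.commute)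
    qed
    also have "\<dots> = e' * N" by (simp add: N_def)
    also have "\<dots> \<le> e" using N that by (simp add: e'_def field_simps)
    finally show ?thesis by simp
  qed
  then have "integral {-1..1} (\<lambda>t. g t * g t) \<le> 0" by (rule field_le_epsilon)
  moreover have "0 \<le> integral {-1..1} (\<lambda>t. g t * g t)"
    by (rule integral_nonneg) (auto intro!: integrable_continuous_real continuous_intros g)
  ultimately have int0: "integral {-1..1} (\<lambda>t. g t * g t) = 0" by simp
  have "continuous_on {-1..1} (\<lambda>t. g t * g t)" by (intro continuous_intros g)
  then have "\<forall>t\<in>{-1..1}. g t * g t = 0"
    by (rule integral_eq_0_iff[THEN iffD1, OF _ _ _ int0]) simp_all
  then have "g t * g t = 0" using t by (rule bspec)
  then show ?thesis by (simp only: mult_eq_0_iff disj_absorb)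
qed

text \<open>The moments of y^2 on the unit half circle: the Beta function at ((n + 1) / 2, 2) for
  even n, and 0 for odd n.\<close>

definition beta_moment :: "nat \<Rightarrow> real" where
  "beta_moment n = integral {-1..1} (\<lambda>t. (1 - t\<^sup>2) * t ^ n)"

lemma beta_moment_0: "beta_moment 0 = 4 / 3"
proof -
  have "((\<lambda>t. 1 - t\<^sup>2) has_integral (1 - 1 ^ 3 / 3) - (- 1 - (- 1) ^ 3 / 3)) {-1..1::real}"
    by (rule fundamental_theorem_of_calculus)
      (auto intro!: derivative_eq_intros simp flip: has_real_derivative_iff_has_vector_derivative)
  then show ?thesis unfolding beta_moment_def by (simp add: integral_unique)
qed

text \<open>The moment equation of the exact solution y^2, where r^2 (r^2)'' = 2 r^2 yields the last
  term.\<close>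

lemma beta_moment_rec:
  "real ((n + 1) * (n + 2)) * beta_moment n =
    real (n * (n - 1)) * beta_moment (n - 2) + 2 * beta_moment n"
proof -
  \<comment> \<open>The boundary form u' w - u w' for u = 1 - t^2 and w = (1 - t^2) t^n. It vanishes
    at both ends.\<close>
  let ?F = "\<lambda>t::real. - (real n * t ^ (n - 1) * (1 - t\<^sup>2)\<^sup>2)"
  let ?f = "\<lambda>t. (real ((n + 1) * (n + 2)) - 2) * ((1 - t\<^sup>2) * t ^ n) -
    real (n * (n - 1)) * ((1 - t\<^sup>2) * t ^ (n - 2))"
  have "(?f has_integral ?F 1 - ?F (- 1)) {-1..1}"
  proof (rule fundamental_theorem_of_calculus)
    fix t :: real
    have m: "real n * t ^ (n - 1) * t = real n * t ^ n" by (cases n) auto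
    have n1: "real n * (real (n - 1) * t ^ (n - 1 - 1)) = real (n * (n - 1)) * t ^ (n - 2)"
      by (simp add: numeral_2_eq_2)
    have m2: "real (n * (n - 1)) * t ^ (n - 2) * t\<^sup>2 = real (n * (n - 1)) * t ^ n"
      by (cases n; cases "n - 1") (auto simp: power2_eq_square)
    have "(?F has_real_derivative - (real n * (real (n - 1) * t ^ (n - 1 - 1)) * (1 - t\<^sup>2)\<^sup>2 +
        real n * t ^ (n - 1) * (2 * (1 - t\<^sup>2) * (- 2 * t)))) (at t)"
      by (auto intro!: derivative_eq_intros)
    also have "real n * t ^ (n - 1) * (2 * (1 - t\<^sup>2) * (- 2 * t)) = - 4 * (1 - t\<^sup>2) * (real n * t ^ (n - 1) * t)"
      by (simp add: algebra_simps)
    also have "real n * (real (n - 1) * t ^ (n - 1 - 1)) * (1 - t\<^sup>2)\<^sup>2 =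
        (1 - t\<^sup>2) * (real (n * (n - 1)) * t ^ (n - 2) - real (n * (n - 1)) * t ^ (n - 2) * t\<^sup>2)"
      unfolding n1 by (simp add: algebra_simps power2_eq_square)
    finally have "(?F has_real_derivative ?f t) (at t)"
      unfolding m m2 by (rule DERIV_cong) (cases n; simp add: algebra_simps)
    then show "(?F has_vector_derivative ?f t) (at t within {-1..1})"
      by (simp add: has_field_derivative_at_within has_real_derivative_iff_has_vector_derivative[symmetric])
  qed simp
  then have "integral {-1..1} ?f = 0" by (simp add: integral_unique)
  moreover have "integral {-1..1} ?f = (real ((n + 1) * (n + 2)) - 2) * beta_moment n -
      real (n * (n - 1)) * beta_moment (n - 2)"
    unfolding beta_moment_def
    by (intro integral_unique has_integral_diff has_integral_mult_right integrable_integral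
        integrable_continuous_real continuous_intros)
  ultimately have "(real ((n + 1) * (n + 2)) - 2) * beta_moment n -
      real (n * (n - 1)) * beta_moment (n - 2) = 0"
    by metis
  then show ?thesis by (simp only: left_diff_distrib)
qed

lemma moment_le_integral_abs:
  assumes "continuous_on closed_upper_half_plane f" "0 \<le> r"
  shows "\<bar>moment f n r\<bar> \<le> integral {-1..1} (\<lambda>t. \<bar>f (polar r t)\<bar>)"
proof -
  note cont = continuous_on_closed_polar_slice[OF assms]
  have "norm (integral {-1..1} (\<lambda>t. f (polar r t) * t ^ n)) \<le> integral {-1..1} (\<lambda>t. \<bar>f (polar r t)\<bar>)"
  proof (intro integral_norm_bound_integral integrable_continuous_real continuous_intros cont)
    fix t :: real assume "t \<in> {-1..1}"
    then have "\<bar>t ^ n\<bar> \<le> 1" by (simp add: power_abs power_le_one abs_le_iff)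
    then show "norm (f (polar r t) * t ^ n) \<le> \<bar>f (polar r t)\<bar>"
      by (simp add: abs_mult mult_left_le)
  qed
  then show ?thesis by (simp add: moment_def)
qed

text \<open>Puts the growth terms of the lower bound under the common majorant 1 + r^2; exponent 1
  serves for |x|.\<close>

lemma powr_le_one_plus_square:
  fixes r \<delta> :: real
  assumes "0 \<le> r" "0 \<le> \<delta>" "\<delta> \<le> 2"
  shows "r powr \<delta> \<le> 1 + r\<^sup>2"
proof (cases "r \<le> 1")
  case True
  then have "r powr \<delta> \<le> 1" using assms by (intro powr_le1) auto
  then show ?thesis by (smt (verit) zero_le_power2)
next
  case False
  then have "r powr \<delta> \<le> r powr 2" using assms by (intro powr_mono) auto
  also have "\<dots> = r\<^sup>2" using False by (simp add: powr_numeral)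
  finally show ?thesis by simp
qed

section \<open>Identification of \<phi> from its moments\<close>

context
  fixes \<phi> :: "real \<times> real \<Rightarrow> real"
  assumes cont: "continuous_on closed_upper_half_plane \<phi>" and zero: "\<And>x. \<phi> (x, 0) = 0"
    and C2: "C2_on upper_half_plane \<phi>"
    and eq: "\<And>x y. y > 0 \<Longrightarrow>
      y * (pderiv_x (pderiv_x \<phi>) (x, y) + pderiv_y (pderiv_y \<phi>) (x, y)) - pderiv_y \<phi> (x, y) = 0"
begin

text \<open>Growth at infinity cannot decide here, as r^2 solves the homogeneous equation. Instead c
  r^2 is matched at an outer radius R, which makes the outer barrier term 0, and boundedness near
  the origin lets the inner one, of order a / r, disappear.\<close>

lemma moment_0_quadratic:
  assumes "0 < r"
  shows "moment \<phi> 0 r = moment \<phi> 0 1 * r\<^sup>2"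
proof -
  have scale: "moment \<phi> 0 r = moment \<phi> 0 R / R\<^sup>2 * r\<^sup>2" if rR: "0 < r" "r < R" for r R
  proof -
    define c where "c = moment \<phi> 0 R / R\<^sup>2"
    define d where "d r = moment \<phi> 0 r + (- c) * r\<^sup>2" for r
    have "weak_ode (\<lambda>r. real ((0 + 1) * (0 + 2)) * moment \<phi> 0 r -
        real (0 * (0 - 1)) * moment \<phi> (0 - 2) r + 2 * (- c) * r\<^sup>2) d"
      unfolding d_def by (rule weak_ode_add_square[OF weak_ode_moment[OF cont zero C2 eq]])
    then have ode: "weak_ode (\<lambda>r. real ((0 + 1) * (0 + 2)) * d r) d"
      by (rule weak_ode_cong) (simp add: d_def algebra_simps)
    \<comment> \<open>Taken with \<epsilon> = 1, since only boundedness up to the radius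
      \<open>R\<close> matters.\<close>
    obtain D where D: "0 \<le> D" "\<And>r t. r \<in> {0..R} \<Longrightarrow> t \<in> {-1..1} \<Longrightarrow> \<bar>\<phi> (polar r t)\<bar> \<le> 1 + D * (1 - t\<^sup>2) ^ 3"
      using vanishing_boundary_bound[OF cont zero zero_less_one] by blast
    define K where "K = 2 * (1 + D) + \<bar>c\<bar> * R\<^sup>2"
    have K: "\<bar>d s\<bar> \<le> K" if "0 < s" "s \<le> R" for s
    proof -
      have "norm (integral {-1..1} (\<lambda>t. \<phi> (polar s t) * t ^ 0)) \<le> (1 + D) * (1 - - 1)"
      proof (rule integral_bound)
        show "continuous_on {-1..1} (\<lambda>t. \<phi> (polar s t) * t ^ 0)"
          using continuous_on_closed_polar_slice[OF cont, of s] that by simp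
        fix t :: real assume t: "t \<in> {-1..1}"
        have "(1 - t\<^sup>2) ^ 3 \<le> 1" using t by (intro power_le_one) (auto simp: abs_square_le_1 abs_le_iff)
        then have "D * (1 - t\<^sup>2) ^ 3 \<le> D * 1" by (rule mult_left_mono[OF _ D(1)])
        then show "norm (\<phi> (polar s t) * t ^ 0) \<le> 1 + D" using D(2)[of s t] that t by simp
      qed simp
      moreover have "\<bar>c * s\<^sup>2\<bar> \<le> \<bar>c\<bar> * R\<^sup>2"
        using that by (auto simp: abs_mult intro!: mult_left_mono power_mono)
      ultimately show ?thesis by (simp add: d_def moment_def K_def)
    qed
    have K0: "0 \<le> K" using D by (simp add: K_def)
    have "d r = 0"
    proof (rule weak_ode_zero[OF ode])
      fix e :: real assume e: "0 < e"
      define a where "a = min r (e * r / (K + 1))"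
      have a: "0 < a" "a \<le> r" "a \<le> e * r / (K + 1)" using rR e K0 by (auto simp: a_def)
      have "K * (a / r) \<le> (K + 1) * (a / r)" using a by (intro mult_right_mono) auto
      also have "\<dots> \<le> e" using a(3) rR K0 by (simp add: field_simps)
      finally have "K * (a / r) ^ (0 + 1) + 0 * (r / R) ^ (0 + 2) \<le> e" by simp
      moreover have "\<bar>d R\<bar> \<le> 0" using rR by (simp add: d_def c_def)
      ultimately show "\<exists>a b \<alpha> \<beta>. 0 < a \<and> a \<le> r \<and> r \<le> b \<and> a < b \<and> \<bar>d a\<bar> \<le> \<alpha> \<and> \<bar>d b\<bar> \<le> \<beta> \<and>
          \<alpha> * (a / r) ^ (0 + 1) + \<beta> * (r / b) ^ (0 + 2) \<le> e"
        using a rR K[of a]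
        by (intro exI[of _ a] exI[of _ R] exI[of _ K] exI[of _ 0]) auto
    qed
    then show ?thesis by (simp add: d_def c_def)
  qed
  \<comment> \<open>\<open>scale\<close> compares with a larger radius, so 1 acts as the outer or as
    the inner one.\<close>
  consider "r < 1" | "r = 1" | "1 < r" by linarith
  then show ?thesis
  proof cases
    case 1 then show ?thesis using scale[of r 1] assms by simp
  next
    case 3 then show ?thesis using scale[of 1 r] by simp
  qed simp
qed

lemma polar_quadratic:
  assumes N: "\<And>r t. 0 < r \<Longrightarrow> t \<in> {-1..1} \<Longrightarrow> - N * (1 + r\<^sup>2) \<le> \<phi> (polar r t)" "0 \<le> N"
    and r: "0 < r" and t: "t \<in> {-1..1}"
  shows "\<phi> (polar r t) = 3 / 4 * moment \<phi> 0 1 * r\<^sup>2 * (1 - t\<^sup>2)"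
proof -
  \<comment> \<open>\<open>3 / 4\<close> is the inverse of \<open>beta_moment 0\<close>, so \<kappa>
    y^2 has the same moment of order 0 as \<phi>.\<close>
  define \<kappa> where "\<kappa> = 3 / 4 * moment \<phi> 0 1"
  \<comment> \<open>From |\<phi>| <= \<phi> + 2 N (1 + s^2), integrated over an interval of length
    2. The integral of \<phi> itself is already known to be quadratic in s.\<close>
  define K where "K = \<bar>moment \<phi> 0 1\<bar> + 4 * N"
  have K: "\<bar>moment \<phi> n s\<bar> \<le> K * (1 + s\<^sup>2)" if s: "0 < s" for n s
  proof -
    note slice = continuous_on_closed_polar_slice[OF cont less_imp_le[OF s]]
    have int: "(\<lambda>t. \<phi> (polar s t)) integrable_on {-1..1}"
      using slice by (rule integrable_continuous_real)
    have "\<bar>moment \<phi> n s\<bar> \<le> integral {-1..1} (\<lambda>t. \<bar>\<phi> (polar s t)\<bar>)"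
      using s by (intro moment_le_integral_abs cont) auto
    also have "\<dots> \<le> integral {-1..1} (\<lambda>t. \<phi> (polar s t) + 2 * N * (1 + s\<^sup>2))"
    proof (intro integral_le integrable_continuous_real continuous_intros slice)
      fix t :: real assume "t \<in> {-1..1}"
      then have "- (N * (1 + s\<^sup>2)) \<le> \<phi> (polar s t)"
        using N(1)[OF s] by (simp only: mult_minus_left)
      moreover have "0 \<le> N * (1 + s\<^sup>2)" using N(2) by simp
      ultimately have "\<bar>\<phi> (polar s t)\<bar> \<le> \<phi> (polar s t) + 2 * (N * (1 + s\<^sup>2))"
        unfolding abs_le_iff by linarith
      then show "\<bar>\<phi> (polar s t)\<bar> \<le> \<phi> (polar s t) + 2 * N * (1 + s\<^sup>2)"
        by (simp only: mult.assoc)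
    qed
    also have "\<dots> = moment \<phi> 0 s + 4 * N * (1 + s\<^sup>2)"
      by (subst integral_add[OF int]) (auto simp: moment_def)
    also have "\<dots> \<le> \<bar>moment \<phi> 0 1\<bar> * (1 + s\<^sup>2) + 4 * N * (1 + s\<^sup>2)"
      unfolding moment_0_quadratic[OF s] by (intro add_right_mono mult_mono) auto
    finally show ?thesis by (simp add: K_def algebra_simps)
  qed
  \<comment> \<open>The equation refers back to n - 2. For n = 1 this is 0 by truncation, still
    below n, with coefficient n (n - 1) = 0.\<close>
  have mom: "moment \<phi> n s = \<kappa> * beta_moment n * s\<^sup>2" if "0 < s" for n s
    using that
  proof (induction n arbitrary: s rule: less_induct)
    case (less n)
    show ?case
    proof (cases "n = 0")
      case True
      then show ?thesis
        using moment_0_quadratic[OF less.prems] by (simp add: \<kappa>_def beta_moment_0)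
    next
      case False
      \<comment> \<open>c r^2 is the n-th moment of \<kappa> y^2. By the induction hypothesis and
        \<open>beta_moment_rec\<close>, subtracting it leaves the homogeneous equation.\<close>
      define c where "c = \<kappa> * beta_moment n"
      define d where "d r = moment \<phi> n r + (- c) * r\<^sup>2" for r
      have "weak_ode (\<lambda>r. real ((n + 1) * (n + 2)) * moment \<phi> n r -
          real (n * (n - 1)) * moment \<phi> (n - 2) r + 2 * (- c) * r\<^sup>2) d"
        unfolding d_def by (rule weak_ode_add_square[OF weak_ode_moment[OF cont zero C2 eq]])
      then have "weak_ode (\<lambda>r. real ((n + 1) * (n + 2)) * d r) d"
      proof (rule weak_ode_cong)
        fix r :: real assume "0 < r"
        define L M where "L = real ((n + 1) * (n + 2))" and "M = real (n * (n - 1))"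
        have IH: "moment \<phi> (n - 2) r = \<kappa> * beta_moment (n - 2) * r\<^sup>2"
          using less.IH[of "n - 2" r] False \<open>0 < r\<close> by simp
        have rec: "L * beta_moment n = M * beta_moment (n - 2) + 2 * beta_moment n"
          unfolding L_def M_def by (rule beta_moment_rec)
        have "L * moment \<phi> n r - M * moment \<phi> (n - 2) r + 2 * (- c) * r\<^sup>2 =
            L * moment \<phi> n r - \<kappa> * r\<^sup>2 * (M * beta_moment (n - 2) + 2 * beta_moment n)"
          unfolding IH c_def by (simp add: algebra_simps)
        also have "\<dots> = L * d r"
          unfolding rec[symmetric] d_def c_def by (simp add: algebra_simps)
        finally show "real ((n + 1) * (n + 2)) * moment \<phi> n r -
            real (n * (n - 1)) * moment \<phi> (n - 2) r + 2 * (- c) * r\<^sup>2 =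
            real ((n + 1) * (n + 2)) * d r" unfolding L_def M_def .
      qed
      then have "d s = 0"
      proof (rule weak_ode_zero_of_growth)
        fix s :: real assume "0 < s"
        have "\<bar>d s\<bar> \<le> \<bar>moment \<phi> n s\<bar> + \<bar>c\<bar> * s\<^sup>2"
          unfolding d_def by (rule order_trans[OF abs_triangle_ineq]) (simp add: abs_mult)
        also have "\<dots> \<le> K * (1 + s\<^sup>2) + \<bar>c\<bar> * (1 + s\<^sup>2)"
          by (intro add_mono mult_left_mono K \<open>0 < s\<close>) auto
        finally show "\<bar>d s\<bar> \<le> (K + \<bar>c\<bar>) * (1 + s\<^sup>2)" by (simp add: algebra_simps)
      qed (use False less.prems in auto)
      then show ?thesis by (simp add: d_def c_def)
    qed
  qed
  note slice = continuous_on_closed_polar_slice[OF cont less_imp_le[OF r]]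
  have "\<phi> (polar r t) - \<kappa> * r\<^sup>2 * (1 - t\<^sup>2) = 0"
  proof (rule zero_of_moments_zero[OF _ _ t])
    show "continuous_on {-1..1} (\<lambda>t. \<phi> (polar r t) - \<kappa> * r\<^sup>2 * (1 - t\<^sup>2))"
      by (intro continuous_intros slice)
    fix n
    have "((\<lambda>t. \<phi> (polar r t) * t ^ n - \<kappa> * r\<^sup>2 * ((1 - t\<^sup>2) * t ^ n)) has_integral
        moment \<phi> n r - \<kappa> * r\<^sup>2 * beta_moment n) {-1..1}"
      unfolding moment_def beta_moment_def
      by (intro has_integral_diff has_integral_mult_right integrable_integral
          integrable_continuous_real continuous_intros slice)
    then have "integral {-1..1} (\<lambda>t. \<phi> (polar r t) * t ^ n - \<kappa> * r\<^sup>2 * ((1 - t\<^sup>2) * t ^ n)) =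
        moment \<phi> n r - \<kappa> * r\<^sup>2 * beta_moment n" by (rule integral_unique)
    also have "\<dots> = 0" unfolding mom[OF r, of n] by simp
    finally show "integral {-1..1} (\<lambda>t. (\<phi> (polar r t) - \<kappa> * r\<^sup>2 * (1 - t\<^sup>2)) * t ^ n) = 0"
      by (simp only: left_diff_distrib mult.assoc)
  qed
  then show ?thesis by (simp add: \<kappa>_def)
qed

end

theorem theorem1p5:
  fixes \<phi> :: "real \<times> real \<Rightarrow> real" and A B C \<delta> :: real
  assumes "continuous_on closed_upper_half_plane \<phi>"
    and "C2_on upper_half_plane \<phi>"
    and "\<forall>(x, y) \<in> upper_half_plane.
           y * (pderiv_x (pderiv_x \<phi>) (x, y) + pderiv_y (pderiv_y \<phi>) (x, y)) - pderiv_y \<phi> (x, y) = 0"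
    and "\<forall>x. \<phi> (x, 0) = 0"
    and "A \<ge> 0" and "B \<ge> 0" and "C \<ge> 0" and "0 \<le> \<delta>" and "\<delta> < 2"
    and "\<forall>(x, y) \<in> upper_half_plane. \<phi> (x, y) > - A - B * \<bar>x\<bar> - C * y powr \<delta>"
  shows "(\<forall>(x, y) \<in> closed_upper_half_plane. \<phi> (x, y) \<ge> 0) \<and>
         (\<exists>C1\<ge>0. \<forall>(x, y) \<in> closed_upper_half_plane. \<phi> (x, y) = C1 * y\<^sup>2)"
proof -
  have zero: "\<phi> (x, 0) = 0" for x using assms(4) by simp
  have eq: "y * (pderiv_x (pderiv_x \<phi>) (x, y) + pderiv_y (pderiv_y \<phi>) (x, y)) - pderiv_y \<phi> (x, y) = 0"
    if "y > 0" for x y using assms(3) that by (auto simp: upper_half_plane_def)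
  have lower: "\<phi> (x, y) > - A - B * \<bar>x\<bar> - C * y powr \<delta>" if "y > 0" for x y
    using assms(10) that by (auto simp: upper_half_plane_def)
  define N where "N = A + B + C"
  have N0: "0 \<le> N" using assms(5-7) by (simp add: N_def)
  have N: "- N * (1 + r\<^sup>2) \<le> \<phi> (polar r t)" if r: "0 < r" and t: "t \<in> {-1..1}" for r t
  proof -
    have N1: "0 \<le> N * (1 + r\<^sup>2)" using N0 by simp
    have y: "0 \<le> r * sqrt (1 - t\<^sup>2)" "r * sqrt (1 - t\<^sup>2) \<le> r"
      using r t by (auto simp: mult_left_le abs_square_le_1 abs_le_iff)
    show ?thesis
    \<comment> \<open>The lower bound is given for y > 0 only; at the ends of the half circle \<phi>
      vanishes.\<close>
    proof (cases "r * sqrt (1 - t\<^sup>2) = 0")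
      case True
      then have "polar r t = (r * t, 0)" by (simp only: polar_def)
      then show ?thesis using N1 zero by simp
    next
      case False
      have "r \<le> 1 + r\<^sup>2" using powr_le_one_plus_square[of r 1] r by simp
      moreover have "\<bar>r * t\<bar> \<le> r" using r t by (simp add: abs_mult mult_left_le abs_le_iff)
      ultimately have 1: "B * \<bar>r * t\<bar> \<le> B * (1 + r\<^sup>2)" by (intro mult_left_mono assms(6)) simp
      have "(r * sqrt (1 - t\<^sup>2)) powr \<delta> \<le> r powr \<delta>" using y assms(8) by (intro powr_mono2)
      also have "\<dots> \<le> 1 + r\<^sup>2" using r assms(8,9) by (intro powr_le_one_plus_square) auto
      finally have 2: "C * (r * sqrt (1 - t\<^sup>2)) powr \<delta> \<le> C * (1 + r\<^sup>2)"
        by (rule mult_left_mono[OF _ assms(7)])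
      have 3: "A \<le> A * (1 + r\<^sup>2)" using assms(5) by (simp add: algebra_simps)
      show ?thesis
        using lower[of "r * sqrt (1 - t\<^sup>2)" "r * t"] y(1) False 1 2 3
        unfolding polar_def N_def mult_minus_left distrib_right[of "A + B"] distrib_right[of A B]
        by linarith
    qed
  qed
  define \<kappa> where "\<kappa> = 3 / 4 * moment \<phi> 0 1"
  have sol: "\<phi> (x, y) = \<kappa> * y\<^sup>2" if "y \<ge> 0" for x y
  proof (cases "y = 0")
    case True then show ?thesis using zero by simp
  next
    case False
    define r where "r = sqrt (x\<^sup>2 + y\<^sup>2)"
    have r: "0 < r" "r\<^sup>2 = x\<^sup>2 + y\<^sup>2" using False by (auto simp: r_def add_nonneg_pos)
    have "\<bar>x\<bar> \<le> r" by (simp add: r_def real_le_rsqrt)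
    then have "\<bar>x / r\<bar> \<le> 1" using r(1) by simp
    then have t: "x / r \<in> {-1..1}" unfolding abs_le_iff by auto
    have ry: "r\<^sup>2 * (1 - (x / r)\<^sup>2) = y\<^sup>2" using r by (simp add: power_divide right_diff_distrib)
    have "r * sqrt (1 - (x / r)\<^sup>2) = sqrt (r\<^sup>2 * (1 - (x / r)\<^sup>2))"
      by (simp only: real_sqrt_mult real_sqrt_abs abs_of_pos[OF r(1)])
    then have "polar r (x / r) = (x, y)" using r that ry by (simp add: polar_def)
    then have "\<phi> (x, y) = \<kappa> * r\<^sup>2 * (1 - (x / r)\<^sup>2)"
      using polar_quadratic[OF assms(1) zero assms(2) eq N N0 r(1) t] by (simp only: \<kappa>_def)
    then show ?thesis by (simp only: ry mult.assoc)
  qed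
  \<comment> \<open>On the axis x = 0 the term with \<open>B\<close> disappears. Divided by y^2, the
    lower bound tends to 0 as y grows, since the exponents -2 and \<delta> - 2 are negative.\<close>
  have "\<kappa> \<ge> 0"
  proof -
    have powr: "((\<lambda>y. y powr s) \<longlongrightarrow> 0) at_top" if "s < 0" for s :: real
      using that filterlim_ident by (rule tendsto_neg_powr)
    have lim: "((\<lambda>y. - A * y powr (- 2) - C * y powr (\<delta> - 2)) \<longlongrightarrow> - A * 0 - C * 0) at_top"
      by (intro tendsto_diff tendsto_mult tendsto_const powr) (use assms(9) in auto)
    have ev: "\<forall>\<^sub>F y in at_top. - A * y powr (- 2) - C * y powr (\<delta> - 2) \<le> \<kappa>"
    proof (rule eventually_mono[OF eventually_gt_at_top[of 0]])
      fix y :: real assume y: "0 < y"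
      have p: "y powr (- 2) = 1 / y\<^sup>2" "y powr (\<delta> - 2) = y powr \<delta> / y\<^sup>2"
        using y by (simp_all add: powr_minus powr_diff powr_numeral field_simps)
      have "- A - C * y powr \<delta> < \<kappa> * y\<^sup>2" using lower[OF y, of 0] sol[of y 0] y by simp
      then have "(- A - C * y powr \<delta>) / y\<^sup>2 < \<kappa>" using y by (simp add: pos_divide_less_eq)
      then show "- A * y powr (- 2) - C * y powr (\<delta> - 2) \<le> \<kappa>"
        unfolding p by (simp add: diff_divide_distrib)
    qed
    show ?thesis using tendsto_upperbound[OF lim ev] by simp
  qed
  have "\<forall>(x, y) \<in> closed_upper_half_plane. \<phi> (x, y) = \<kappa> * y\<^sup>2"
    using sol by (auto simp: closed_upper_half_plane_def)
  moreover have "\<forall>(x, y) \<in> closed_upper_half_plane. \<phi> (x, y) \<ge> 0"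
    using sol \<open>\<kappa> \<ge> 0\<close> by (auto simp: closed_upper_half_plane_def)
  ultimately show ?thesis using \<open>\<kappa> \<ge> 0\<close> by blast
qed

end
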